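(* Let $G$ be a graph and let $\mu$ be an infinite cardinal. Then $\operatorname{col}(G)>\mu$ if and only if $G$ contains some $\mu$-obstruction (of type I or of type II) as a (not necessarily induced) subgraph.
   Context: Graphs are simple and undirected, possibly infinite; $N(v)$ denotes the set of neighbours of a vertex $v$. The colouring number $\operatorname{col}(G)$ of a graph $G=(V,E)$ is the smallest cardinal $\kappa$ such that there exists a well-ordering $<^*$ of $V$ with $|N(v)\cap\{w : w<^* v\}|<\kappa$ for all $v\in V$. Let $\mu$ be an infinite cardinal. (1) A $\mu$-obstruction of type I is a bipartite graph $H$ with bipartition $(A,B)$ such that for some cardinal $\lambda\ge\mu$: $|A|=\lambda$ and $|B|=\lambda^+$; every vertex of $B$ has at least $\mu$ neighbours in $A$; and every vertex of $A$ has $\lambda^+$ neighbours in $B$. (2) Let $\kappa>\mu$ be a regular cardinal and let $H$ be a graph with $V(H)=\kappa$. Define $T_H$ to be the set of those $\alpha\in\kappa$ such that $\operatorname{cf}(\alpha)=\operatorname{cf}(\mu)$, the order type of $N(\alpha)\cap\alpha$ is $\mu$, and the supremum of $N(\alpha)\cap\alpha$ is $\alpha$ (neighbourhoods taken in $H$; ordinals are identified with the set of smaller ordinals). If $T_H$ is stationary in $\kappa$, then $H$ is a $\mu$-obstruction of type II. Graphs isomorphic to such graphs are also called $\mu$-obstructions of type II. *)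

theory Defs
  imports Main
begin

unbundle cardinal_syntax

section \<open>Graphs\<close>

text \<open>The edge set is a symmetric irreflexive relation: the edge \<open>uv\<close> is represented by the
  two pairs \<open>(u, v)\<close> and \<open>(v, u)\<close>.\<close>

record 'a ugraph =
  verts :: "'a set"
  edges :: "'a rel"

definition simple_graph :: "'a ugraph \<Rightarrow> bool" where
  "simple_graph G \<longleftrightarrow> edges G \<subseteq> verts G \<times> verts G \<and> sym (edges G) \<and> irrefl (edges G)"

definition nbrs :: "'a ugraph \<Rightarrow> 'a \<Rightarrow> 'a set" where
  "nbrs G v = {w. (v, w) \<in> edges G}"

definition subgraph :: "'a ugraph \<Rightarrow> 'a ugraph \<Rightarrow> bool" where
  "subgraph H G \<longleftrightarrow> simple_graph H \<and> verts H \<subseteq> verts G \<and> edges H \<subseteq> edges G"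

definition graph_iso :: "'a ugraph \<Rightarrow> 'b ugraph \<Rightarrow> bool" where
  "graph_iso G H \<longleftrightarrow> (\<exists>f. bij_betw f (verts G) (verts H) \<and>
     (\<forall>u\<in>verts G. \<forall>v\<in>verts G. (u, v) \<in> edges G \<longleftrightarrow> (f u, f v) \<in> edges H))"

definition bipartition :: "'a ugraph \<Rightarrow> 'a set \<Rightarrow> 'a set \<Rightarrow> bool" where
  "bipartition H A B \<longleftrightarrow> verts H = A \<union> B \<and> A \<inter> B = {} \<and> edges H \<subseteq> A \<times> B \<union> B \<times> A"


section \<open>Colouring number and cofinality\<close>

text \<open>A cardinal is a relation satisfying \<^const>\<open>Card_order\<close>, unique only up to \<^const>\<open>ordIso\<close>;
  accordingly "the smallest cardinal" of a class is a chosen representative.\<close>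

definition least_card :: "'a rel set \<Rightarrow> 'a rel" where
  "least_card S = (SOME c. c \<in> S \<and> (\<forall>d\<in>S. c \<le>o d))"

lemma least_card:
  assumes "S \<noteq> {}" and "\<And>c. c \<in> S \<Longrightarrow> Card_order c"
  shows "least_card S \<in> S" and "d \<in> S \<Longrightarrow> least_card S \<le>o d"
proof -
  have "\<exists>c. c \<in> S \<and> (\<forall>d\<in>S. c \<le>o d)"
    using exists_minim_Card_order[of S] assms by blast
  from someI_ex[OF this] show "least_card S \<in> S" and "d \<in> S \<Longrightarrow> least_card S \<le>o d"
    unfolding least_card_def by blast+
qed

text \<open>\<open>s\<close> is the reflexive version of the well-ordering of the vertices, so the vertices
  strictly below \<open>v\<close> form \<open>underS s v\<close>.\<close>

definition col_bound :: "'a ugraph \<Rightarrow> 'b rel \<Rightarrow> bool" where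
  "col_bound G \<kappa> \<longleftrightarrow>
     (\<exists>s. well_order_on (verts G) s \<and> (\<forall>v\<in>verts G. |nbrs G v \<inter> underS s v| <o \<kappa>))"

text \<open>It suffices to minimise over cardinals on the vertex type, since \<open>|verts G|\<close> is always a
  bound; see \<open>col_least\<close> for cardinals on other types.\<close>

definition col :: "'a ugraph \<Rightarrow> 'a rel" where
  "col G = least_card {\<kappa>. Card_order \<kappa> \<and> col_bound G \<kappa>}"

lemma col_bound_card_of: "col_bound G |verts G|"
proof -
  have "|nbrs G v \<inter> underS |verts G| v| <o |verts G|" if "v \<in> verts G" for v
    using card_of_underS[OF card_of_Card_order, of v "verts G"] that
      ordLeq_ordLess_trans[OF card_of_mono1[OF Int_lower2]] by (metis Field_card_of)
  then show ?thesis
    unfolding col_bound_def using card_of_well_order_on by blast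
qed

lemma col_bound_mono: "col_bound G \<kappa> \<Longrightarrow> \<kappa> \<le>o \<kappa>' \<Longrightarrow> col_bound G \<kappa>'"
  unfolding col_bound_def using ordLess_ordLeq_trans by blast

lemma Card_order_col: "Card_order (col G)"
  and col_bound_col: "col_bound G (col G)"
  using least_card(1)[of "{\<kappa>. Card_order \<kappa> \<and> col_bound G \<kappa>}"]
    col_bound_card_of[of G] card_of_Card_order
  unfolding col_def by blast+

lemma col_least:
  fixes \<kappa> :: "'b rel" and G :: "'a ugraph"
  assumes "Card_order \<kappa>" and "col_bound G \<kappa>"
  shows "col G \<le>o \<kappa>"
proof -
  have le: "col G \<le>o c" if "Card_order c" "col_bound G c" for c :: "'a rel"
    unfolding col_def by (rule least_card(2)) (use that in auto)
  show ?thesis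
  proof (cases "|verts G| \<le>o \<kappa>")
    case True
    then show ?thesis
      using le[OF card_of_Card_order col_bound_card_of] ordLeq_transitive by blast
  next
    case False
    then have "\<kappa> \<le>o |verts G|"
      using assms(1) by (meson card_order_on_well_order_on card_of_Card_order ordLeq_total)
    then obtain A where "A \<subseteq> verts G" and A: "\<kappa> =o |A|"
      using internalize_card_of_ordLeq[of "Field \<kappa>" "|verts G|"] card_of_Field_ordIso[OF assms(1)]
      by (metis Field_card_of ordIso_ordLeq_trans ordIso_symmetric ordIso_transitive)
    then show ?thesis
      using le[OF card_of_Card_order col_bound_mono[OF assms(2) ordIso_imp_ordLeq[OF A]]]
        ordIso_symmetric ordLeq_ordIso_trans by blast
  qed
qed

text \<open>The cofinality of the order type of a well-order. Unlike the library's \<^const>\<open>cofinal\<close>,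
  which is strict, the condition here is satisfiable also for successor ordinals.\<close>

definition cf :: "'a rel \<Rightarrow> 'a rel" where
  "cf r = least_card {|K| |K. K \<subseteq> Field r \<and> (\<forall>a\<in>Field r. \<exists>b\<in>K. (a, b) \<in> r)}"

lemma cf_witness:
  assumes "Well_order r"
  shows "\<exists>K. K \<subseteq> Field r \<and> (\<forall>a\<in>Field r. \<exists>b\<in>K. (a, b) \<in> r) \<and> cf r = |K|"
proof -
  let ?S = "{|K| |K. K \<subseteq> Field r \<and> (\<forall>a\<in>Field r. \<exists>b\<in>K. (a, b) \<in> r)}"
  have "\<forall>a\<in>Field r. (a, a) \<in> r"
    using assms by (simp add: order_on_defs refl_on_def)
  then have "|Field r| \<in> ?S"
    by blast
  then have "least_card ?S \<in> ?S"
    by (intro least_card(1)) (auto simp: card_of_Card_order)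
  then show ?thesis
    unfolding cf_def by blast
qed

lemma cf_least:
  assumes "K \<subseteq> Field r" and "\<forall>a\<in>Field r. \<exists>b\<in>K. (a, b) \<in> r"
  shows "cf r \<le>o |K|"
  unfolding cf_def by (rule least_card(2)) (use assms in \<open>auto simp: card_of_Card_order\<close>)


section \<open>Stationary sets\<close>

text \<open>Points of \<open>Field \<kappa>\<close> play the role of the ordinals below \<open>\<kappa>\<close>, and \<open>underS \<kappa> \<alpha>\<close> that of the
  ordinal \<open>\<alpha>\<close> as the set of smaller ordinals. Suprema are only taken of subsets of some
  \<open>underS \<kappa> \<alpha>\<close>, which are bounded, so \<^const>\<open>wo_rel.supr\<close> is the least upper bound in \<open>\<kappa>\<close>.\<close>

definition club :: "'a rel \<Rightarrow> 'a set \<Rightarrow> bool" where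
  "club \<kappa> C \<longleftrightarrow> C \<subseteq> Field \<kappa> \<and> cofinal C \<kappa> \<and>
     (\<forall>\<delta>\<in>Field \<kappa>. C \<inter> underS \<kappa> \<delta> \<noteq> {} \<and> wo_rel.supr \<kappa> (C \<inter> underS \<kappa> \<delta>) = \<delta> \<longrightarrow> \<delta> \<in> C)"

definition stationary :: "'a rel \<Rightarrow> 'a set \<Rightarrow> bool" where
  "stationary \<kappa> S \<longleftrightarrow> S \<subseteq> Field \<kappa> \<and> (\<forall>C. club \<kappa> C \<longrightarrow> S \<inter> C \<noteq> {})"


section \<open>Obstructions\<close>

text \<open>The cardinals \<open>\<theta>\<close> (usually written lambda) and \<open>\<kappa>\<close> below are bounded by the number of vertices of \<open>H\<close>, hence are
  represented on the vertex type. The type of \<open>\<mu>\<close> is unrelated.\<close>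

definition obstruction_I :: "'m rel \<Rightarrow> 'a ugraph \<Rightarrow> bool" where
  "obstruction_I \<mu> H \<longleftrightarrow> simple_graph H \<and>
     (\<exists>A B. \<exists>\<theta> :: 'a rel. bipartition H A B \<and> Card_order \<theta> \<and> \<mu> \<le>o \<theta> \<and>
        |A| =o \<theta> \<and> |B| =o cardSuc \<theta> \<and>
        (\<forall>b\<in>B. \<mu> \<le>o |nbrs H b \<inter> A| ) \<and>
        (\<forall>a\<in>A. |nbrs H a \<inter> B| =o cardSuc \<theta>))"

definition T_set :: "'m rel \<Rightarrow> 'a rel \<Rightarrow> 'a ugraph \<Rightarrow> 'a set" where
  "T_set \<mu> \<kappa> H = {\<alpha> \<in> Field \<kappa>.
     cf (Restr \<kappa> (underS \<kappa> \<alpha>)) =o cf \<mu> \<and>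
     Restr \<kappa> (nbrs H \<alpha> \<inter> underS \<kappa> \<alpha>) =o \<mu> \<and>
     wo_rel.supr \<kappa> (nbrs H \<alpha> \<inter> underS \<kappa> \<alpha>) = \<alpha>}"

definition standard_obstruction_II :: "'m rel \<Rightarrow> 'a rel \<Rightarrow> 'a ugraph \<Rightarrow> bool" where
  "standard_obstruction_II \<mu> \<kappa> H \<longleftrightarrow>
     Card_order \<kappa> \<and> \<mu> <o \<kappa> \<and> regularCard \<kappa> \<and>
     simple_graph H \<and> verts H = Field \<kappa> \<and> stationary \<kappa> (T_set \<mu> \<kappa> H)"

definition obstruction_II :: "'m rel \<Rightarrow> 'a ugraph \<Rightarrow> bool" where
  "obstruction_II \<mu> H \<longleftrightarrow> simple_graph H \<and>
     (\<exists>(\<kappa> :: 'a rel) (H' :: 'a ugraph). standard_obstruction_II \<mu> \<kappa> H' \<and> graph_iso H H')"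

end

(*
  If a well-order leaves every vertex with fewer than \<mu> earlier neighbours, mapping a vertex to
  these neighbours defines a set mapping that covers every edge; pigeonhole (type I) and a closure
  point in the stationary set (type II) rule this out for an obstruction.

  Conversely, let G have no obstruction. Without type I, at most |X| vertices have at least \<mu>
  neighbours in a set X with |X| \<ge> \<mu>. By induction on |W|, every set W of vertices has a suitable
  well-order: W is exhausted by smaller sets such that every vertex outside an initial union has
  fewer than \<mu> neighbours in it, and the well-orders of the pieces are put one after the other.
  If |W| is regular, take initial segments of a well-order of type |W|; they fail only if there is
  an obstruction of type II. If |W| is singular, close off cofinally many initial segments
  simultaneously.
*)
theory Submission
  imports Defs
begin

section \<open>Well-orders and regular cardinals\<close>

text \<open>In the converse direction, the absence of type I is used only through one inequality:
  \<open>rich \<mu> G X\<close> is no larger than X once X has \<mu> elements. So closing off costs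
  nothing in cardinality, and both cases of the induction rest on this. Two obstacles shape the
  rest. At a regular cardinal, a vertex with \<mu> neighbours below \<delta> may lie far beyond
  \<delta>, whereas type II wants it at position \<delta>; the well-order must be changed without
  disturbing the segments below the relevant \<delta>. At a singular cardinal, closing off the
  segments one at a time is not enough: a union of closed pieces can admit new vertices with \<mu>
  neighbours in it, so the unions themselves must be closed, while each piece stays as small as its
  segment. The order type and the cofinality in \<open>T_set\<close> need no extra choice: they
  follow from having \<mu> neighbours below \<delta> but fewer below every earlier point.\<close>

lemma underS_trans:
  assumes "Well_order r" "a \<in> underS r b" "b \<in> underS r c"
  shows "a \<in> underS r c"
  using assms wo_rel.TRANS[of r] wo_rel.ANTISYM[of r]
  unfolding wo_rel_def underS_def trans_def antisym_def by blast

lemma underS_asym: "Well_order r \<Longrightarrow> a \<in> underS r b \<Longrightarrow> b \<notin> underS r a"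
  using underS_trans underS_notIn by fastforce

lemma underS_linear:
  assumes "Well_order r" "a \<in> Field r" "b \<in> Field r"
  shows "a \<in> underS r b \<or> a = b \<or> b \<in> underS r a"
  using assms wo_rel.TOTALS[of r] unfolding wo_rel_def underS_def by blast

lemma in_Field_underS: "a \<in> underS r b \<Longrightarrow> a \<in> Field r \<and> b \<in> Field r"
  unfolding underS_def Field_def by blast

lemma le_iff_not_underS:
  assumes "Well_order r" "a \<in> Field r" "b \<in> Field r"
  shows "(a, b) \<in> r \<longleftrightarrow> b \<notin> underS r a"
proof -
  have "(a, a) \<in> r"
    using assms by (simp add: order_on_defs refl_on_def)
  then show ?thesis
    using underS_linear[OF assms] underS_asym[OF assms(1), of b a] unfolding underS_def
    using assms wo_rel.ANTISYM[of r, unfolded antisym_def] unfolding wo_rel_def by blast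
qed

lemma underS_subset:
  assumes "Well_order r" "(a, b) \<in> r"
  shows "underS r a \<subseteq> underS r b"
proof (cases "a = b")
  case False
  then have "a \<in> underS r b"
    using assms(2) unfolding underS_def by blast
  then show ?thesis
    using underS_trans[OF assms(1)] by blast
qed simp

lemma Well_order_least:
  assumes "Well_order r" "S \<subseteq> Field r" "S \<noteq> {}"
  obtains m where "m \<in> S" "\<And>x. x \<in> S \<Longrightarrow> x \<notin> underS r m"
proof -
  have "wo_rel r"
    using assms(1) by (simp add: wo_rel_def)
  then obtain m where m: "m \<in> S" "\<forall>x\<in>S. (m, x) \<in> r"
    using wo_rel.Well_order_isMinim_exists[of r S] assms(2,3) wo_rel.isMinim_def by metis
  show ?thesis
    using that[OF m(1)] m le_iff_not_underS[OF assms(1)] assms(2) by blast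
qed

text \<open>For a set strictly below \<delta>, having supremum \<delta> amounts to strict
  unboundedness, since a maximum would be a supremum below \<delta>. With \<open>supr_eqD\<close>
  this lets the later proofs argue by unboundedness alone.\<close>

lemma supr_eqI:
  assumes wo: "Well_order r" and "A \<subseteq> underS r \<delta>" and \<delta>: "\<delta> \<in> Field r"
    and unb: "\<And>x. x \<in> underS r \<delta> \<Longrightarrow> \<exists>a\<in>A. x \<in> underS r a"
  shows "wo_rel.supr r A = \<delta>"
proof -
  have wr: "wo_rel r"
    using wo by (simp add: wo_rel_def)
  have "\<delta> = wo_rel.minim r (Above r A)"
  proof (rule wo_rel.equals_minim[OF wr])
    show "Above r A \<subseteq> Field r"
      unfolding Above_def by blast
    show "\<delta> \<in> Above r A"
      using assms(2) \<delta> unfolding Above_def underS_def by blast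
    fix b assume b: "b \<in> Above r A"
    then have "b \<in> Field r"
      unfolding Above_def by blast
    moreover have "b \<notin> underS r \<delta>"
      using unb[of b] b le_iff_not_underS[OF wo] in_Field_underS unfolding Above_def by fast
    ultimately show "(\<delta>, b) \<in> r"
      using le_iff_not_underS[OF wo] \<delta> by blast
  qed
  then show ?thesis
    unfolding wo_rel.supr_def[OF wr] by simp
qed

lemma supr_eqD:
  assumes wo: "Well_order r" and "A \<subseteq> underS r \<delta>" and \<delta>: "\<delta> \<in> Field r"
    and "wo_rel.supr r A = \<delta>" and x: "x \<in> underS r \<delta>"
  shows "\<exists>a\<in>A. x \<in> underS r a"
proof (rule ccontr)
  assume neg: "\<not> ?thesis"
  have wr: "wo_rel r"
    using wo by (simp add: wo_rel_def)
  have xF: "x \<in> Field r"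
    using x in_Field_underS by fast
  have "(a, x) \<in> r" if "a \<in> A" for a
    using neg that le_iff_not_underS[OF wo _ xF, of a] in_Field_underS[of a r \<delta>] assms(2) by blast
  then have "x \<in> Above r A"
    using xF unfolding Above_def by blast
  then have "(wo_rel.minim r (Above r A), x) \<in> r"
    by (intro wo_rel.minim_least[OF wr]) (auto simp: Above_def)
  then have "(\<delta>, x) \<in> r"
    using assms(4) unfolding wo_rel.supr_def[OF wr] by simp
  then show False
    using le_iff_not_underS[OF wo \<delta>] in_Field_underS x by fast
qed

section \<open>Infinite and regular cardinals\<close>

lemma natLeq_ordLeq: "Card_order \<mu> \<Longrightarrow> infinite (Field \<mu>) \<Longrightarrow> natLeq \<le>o \<mu>"
  using infinite_iff_natLeq_ordLeq[of "Field \<mu>"] card_of_Field_ordIso ordLeq_ordIso_trans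
  by metis

lemma natLeq_ordLess:
  assumes "Card_order \<mu>" "infinite (Field \<mu>)" "\<mu> <o \<kappa>"
  shows "natLeq <o \<kappa>"
  using ordLeq_ordLess_trans[OF natLeq_ordLeq[OF assms(1,2)] assms(3)] .

lemma infinite_Field_ordLeq:
  assumes "infinite (Field \<mu>)" "\<mu> \<le>o \<kappa>"
  shows "infinite (Field \<kappa>)"
  using card_of_ordLeq_infinite[OF card_of_mono2[OF assms(2)] assms(1)] .

lemma not_card_ordLeq_iff: "\<not> |A| \<le>o |B| \<longleftrightarrow> |B| <o |A|"
  using not_ordLeq_iff_ordLess[OF card_of_Well_order card_of_Well_order] .

lemma card_of_Un_ordLeq_infinite:
  assumes "infinite C" "|A| \<le>o |C|" "|B| \<le>o |C|"
  shows "|A \<union> B| \<le>o |C|"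
  using card_of_Un_ordLeq_infinite_Field[of "|C|" A B] card_of_Card_order[of C] assms
  unfolding Field_card_of by blast

lemma card_ordLeq_obtain_subset:
  assumes "Card_order \<mu>" "\<mu> \<le>o |A|"
  obtains B where "B \<subseteq> A" "|B| =o \<mu>"
proof -
  have "|Field \<mu>| \<le>o |A|"
    using ordIso_ordLeq_trans[OF card_of_Field_ordIso[OF assms(1)] assms(2)] .
  then obtain B where "B \<subseteq> A" "|Field \<mu>| =o |B|"
    unfolding internalize_card_of_ordLeq2[of "Field \<mu>" A] by blast
  then show ?thesis
    using that ordIso_transitive[OF ordIso_symmetric card_of_Field_ordIso[OF assms(1)]] by blast
qed

lemma regular_bounded:
  assumes r: "Card_order r" "infinite (Field r)" "regularCard r"
    and "S \<subseteq> Field r" "|S| <o r"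
  obtains b where "b \<in> Field r" "S \<subseteq> underS r b"
proof -
  have wo: "Well_order r"
    using r(1) by (simp add: card_order_on_def)
  have "\<not> cofinal S r"
    using assms not_ordLess_ordIso unfolding regularCard_def by blast
  then obtain a where a: "a \<in> Field r" "\<forall>b\<in>S. \<not> (a \<noteq> b \<and> (a, b) \<in> r)"
    unfolding cofinal_def by blast
  \<comment> \<open>Non-cofinality gives only a weak bound \<open>a\<close>; an infinite cardinal is
    a limit, so a later \<open>b\<close> is a strict one.\<close>
  obtain b where b: "b \<in> Field r" "a \<noteq> b" "(a, b) \<in> r"
    using infinite_Card_order_limit[OF r(1,2) a(1)] by blast
  have "s \<in> underS r b" if "s \<in> S" for s
  proof -
    have "s = a \<or> s \<in> underS r a"
      using underS_linear[OF wo _ a(1), of s] a(2) that assms(4) unfolding underS_def by blast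
    moreover have "a \<in> underS r b"
      using b unfolding underS_def by blast
    ultimately show ?thesis
      using underS_trans[OF wo] by blast
  qed
  then show ?thesis
    using that b(1) by blast
qed

lemma club_unbounded: "club r D \<Longrightarrow> a \<in> Field r \<Longrightarrow> \<exists>d\<in>D. a \<in> underS r d"
  unfolding club_def cofinal_def underS_def by simp

text \<open>The least element always belongs, vacuously. If \<open>h\<close> moves every point up,
  all other members are limits.\<close>

definition closure_points :: "'a rel \<Rightarrow> ('a \<Rightarrow> 'a) \<Rightarrow> 'a set" where
  "closure_points r h = {\<delta> \<in> Field r. \<forall>a\<in>underS r \<delta>. h a \<in> underS r \<delta>}"

text \<open>Above any point runs an \<omega>-sequence along which \<open>h\<close> is dominated; its
  supremum exists since \<open>r\<close> is regular and uncountable, and is a closure point. For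
  closedness, each point below a limit of closure points lies below one of them.\<close>

lemma club_closure_points:
  assumes r: "Card_order r" "natLeq <o r" "regularCard r"
    and h: "\<And>a. a \<in> Field r \<Longrightarrow> h a \<in> Field r"
  shows "club r (closure_points r h)"
  unfolding club_def
proof (intro conjI ballI impI)
  have wo: "Well_order r"
    using r(1) by (simp add: card_order_on_def)
  have inf: "infinite (Field r)"
    using infinite_Field_ordLeq[OF _ ordLess_imp_ordLeq[OF r(2)]] by (simp add: Field_natLeq)
  show "closure_points r h \<subseteq> Field r"
    unfolding closure_points_def by blast
  show "cofinal (closure_points r h) r"
    unfolding cofinal_def
  proof
    fix a assume a: "a \<in> Field r"
    \<comment> \<open>As \<open>h\<close> need not be monotone, the next term must dominate it on
      the whole segment up to \<open>x\<close>, not only at \<open>x\<close>.\<close>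
    have "\<exists>b\<in>Field r. insert x (insert (h x) (h ` underS r x)) \<subseteq> underS r b"
      if x: "x \<in> Field r" for x
    proof -
      have "|underS r x| <o r"
        using card_of_underS[OF r(1) x] .
      then have "|h ` underS r x| <o r"
        using ordLeq_ordLess_trans[OF card_of_image] by blast
      moreover have "|{x, h x}| <o r"
        by (rule finite_ordLess_infinite[OF card_of_Well_order wo _ inf]) (simp add: Field_card_of)
      ultimately have "|{x, h x} \<union> h ` underS r x| <o r"
        using card_of_Un_ordLess_infinite_Field[OF inf r(1)] by blast
      moreover have "{x, h x} \<union> h ` underS r x \<subseteq> Field r"
        using h x in_Field_underS by fast
      ultimately obtain b where "b \<in> Field r" "{x, h x} \<union> h ` underS r x \<subseteq> underS r b"
        using regular_bounded[OF r(1) inf r(3)] by blast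
      then show ?thesis by auto
    qed
    then obtain H where H: "\<And>x. x \<in> Field r \<Longrightarrow> H x \<in> Field r"
      "\<And>x. x \<in> Field r \<Longrightarrow> insert x (insert (h x) (h ` underS r x)) \<subseteq> underS r (H x)"
      by metis
    define s where "s n = (H ^^ n) a" for n :: nat
    have s: "s n \<in> Field r" for n
      by (induction n) (use a H in \<open>auto simp: s_def\<close>)
    have "|range s| <o r"
      by (rule ordLeq_ordLess_trans[OF card_of_image ordIso_ordLess_trans[OF card_of_nat r(2)]])
    then obtain b where b: "b \<in> Field r" "range s \<subseteq> underS r b"
      using regular_bounded[OF r(1) inf r(3), of "range s"] s by blast
    \<comment> \<open>The supremum of the sequence is taken as its least strict upper bound, so
      every smaller point is at most some \<open>s n\<close>.\<close>
    define U where "U = {b \<in> Field r. range s \<subseteq> underS r b}"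
    obtain \<delta> where \<delta>: "\<delta> \<in> U" "\<And>x. x \<in> U \<Longrightarrow> x \<notin> underS r \<delta>"
      using Well_order_least[OF wo, of U] b unfolding U_def by blast
    have \<delta>F: "\<delta> \<in> Field r" and s\<delta>: "s n \<in> underS r \<delta>" for n
      using \<delta> unfolding U_def by auto
    have "h x \<in> underS r \<delta>" if x: "x \<in> underS r \<delta>" for x
    proof -
      have "x \<in> Field r" "x \<notin> U"
        using x \<delta>(2) in_Field_underS by fast+
      then obtain n where "s n \<notin> underS r x"
        unfolding U_def by blast
      then have "x = s n \<or> x \<in> underS r (s n)"
        using underS_linear[OF wo s \<open>x \<in> Field r\<close>] by blast
      then have "h x \<in> underS r (H (s n))"
        using H(2)[OF s] by blast
      moreover have "H (s n) = s (Suc n)"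
        unfolding s_def by simp
      ultimately show ?thesis
        using underS_trans[OF wo _ s\<delta>[of "Suc n"]] by simp
    qed
    then have "\<delta> \<in> closure_points r h"
      using \<delta>F unfolding closure_points_def by blast
    moreover have "a \<noteq> \<delta> \<and> (a, \<delta>) \<in> r"
      using s\<delta>[of 0] unfolding s_def underS_def by simp
    ultimately show "\<exists>b\<in>closure_points r h. a \<noteq> b \<and> (a, b) \<in> r"
      by blast
  qed
  fix \<delta> assume \<delta>: "\<delta> \<in> Field r"
    and *: "closure_points r h \<inter> underS r \<delta> \<noteq> {} \<and> wo_rel.supr r (closure_points r h \<inter> underS r \<delta>) = \<delta>"
  have "h x \<in> underS r \<delta>" if x: "x \<in> underS r \<delta>" for x
  proof -
    obtain c where c: "c \<in> closure_points r h" "c \<in> underS r \<delta>" "x \<in> underS r c"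
      using supr_eqD[OF wo _ \<delta> _ x] * by blast
    then have "h x \<in> underS r c"
      unfolding closure_points_def by blast
    then show ?thesis
      using underS_trans[OF wo _ c(2)] by blast
  qed
  then show "\<delta> \<in> closure_points r h"
    using \<delta> unfolding closure_points_def by blast
qed

section \<open>Obstructions force a large colouring number\<close>

text \<open>In this order-free form the bound passes to subgraphs with the same \<open>f\<close>,
  and along isomorphisms by taking images. The values \<open>f v\<close> may contain points that are
  not vertices.\<close>

definition set_mapping :: "'m rel \<Rightarrow> 'a ugraph \<Rightarrow> ('a \<Rightarrow> 'a set) \<Rightarrow> bool" where
  "set_mapping \<mu> H f \<longleftrightarrow>
    (\<forall>v\<in>verts H. |f v| <o \<mu>) \<and> (\<forall>(u, v)\<in>edges H. u \<in> f v \<or> v \<in> f u)"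

lemma col_bound_imp_set_mapping:
  assumes "simple_graph G" "col_bound G \<mu>"
  shows "\<exists>f. set_mapping \<mu> G f"
proof -
  obtain s where s: "well_order_on (verts G) s" "\<forall>v\<in>verts G. |nbrs G v \<inter> underS s v| <o \<mu>"
    using assms(2) unfolding col_bound_def by blast
  have F: "Field s = verts G" "Well_order s"
    using s(1) well_order_on_Well_order by auto
  have "u \<in> nbrs G v \<inter> underS s v \<or> v \<in> nbrs G u \<inter> underS s u" if "(u, v) \<in> edges G" for u v
  proof -
    have "(v, u) \<in> edges G" "u \<in> verts G" "v \<in> verts G" "u \<noteq> v"
      using that assms(1) unfolding simple_graph_def sym_def irrefl_def by auto
    then show ?thesis
      using that underS_linear[OF F(2), of u v] F(1) unfolding nbrs_def by auto
  qed
  then have "set_mapping \<mu> G (\<lambda>v. nbrs G v \<inter> underS s v)"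
    using s(2) unfolding set_mapping_def by blast
  then show ?thesis
    by blast
qed

lemma set_mapping_subgraph: "subgraph H G \<Longrightarrow> set_mapping \<mu> G f \<Longrightarrow> set_mapping \<mu> H f"
  unfolding set_mapping_def subgraph_def by blast

lemma set_mapping_iso:
  assumes "simple_graph H'" "graph_iso H H'" "set_mapping \<mu> H f"
  shows "\<exists>f'. set_mapping \<mu> H' f'"
proof -
  obtain g where g: "bij_betw g (verts H) (verts H')"
    "\<forall>u\<in>verts H. \<forall>v\<in>verts H. (u, v) \<in> edges H \<longleftrightarrow> (g u, g v) \<in> edges H'"
    using assms(2) unfolding graph_iso_def by blast
  define k where "k = inv_into (verts H) g"
  have k: "k x \<in> verts H" "g (k x) = x" if "x \<in> verts H'" for x
    using g(1) that unfolding k_def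
    by (auto simp: bij_betw_def f_inv_into_f inv_into_into)
  have "set_mapping \<mu> H' (\<lambda>x. g ` f (k x))"
    unfolding set_mapping_def
  proof (intro conjI ballI, goal_cases)
    case (1 v)
    then have "|f (k v)| <o \<mu>"
      using assms(3) k unfolding set_mapping_def by blast
    then show ?case
      by (rule ordLeq_ordLess_trans[OF card_of_image])
  next
    case (2 e)
    then obtain u v where e: "e = (u, v)" "u \<in> verts H'" "v \<in> verts H'" "(u, v) \<in> edges H'"
      using assms(1) unfolding simple_graph_def by auto
    then have "(k u, k v) \<in> edges H"
      using g(2) k by simp
    then have "k u \<in> f (k v) \<or> k v \<in> f (k u)"
      using assms(3) unfolding set_mapping_def by blast
    then show ?case
      using e k by (metis (no_types, lifting) case_prod_conv imageI)
  qed
  then show ?thesis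
    by blast
qed

text \<open>A vertex b of B has \<mu> neighbours in A but fewer than \<mu> elements in
  \<open>f b\<close>, so b lies in \<open>f a\<close> for some neighbour a. Thus B is covered by
  \<theta> sets of size at most \<theta>, too few for the successor of \<theta>.\<close>

lemma obstruction_I_no_set_mapping:
  assumes \<mu>: "Card_order \<mu>" "infinite (Field \<mu>)"
    and "obstruction_I \<mu> H"
  shows "\<not> set_mapping \<mu> H f"
proof
  assume f: "set_mapping \<mu> H f"
  obtain A B and \<theta> :: "'b rel" where AB: "bipartition H A B" and \<theta>: "Card_order \<theta>" "\<mu> \<le>o \<theta>"
    and A: "|A| =o \<theta>" and B: "|B| =o cardSuc \<theta>" and deg: "\<forall>b\<in>B. \<mu> \<le>o |nbrs H b \<inter> A|"
    using assms(3) unfolding obstruction_I_def by blast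
  have inf: "infinite (Field \<theta>)"
    using infinite_Field_ordLeq[OF \<mu>(2) \<theta>(2)] .
  have "B \<subseteq> (\<Union>a\<in>A. f a)"
  proof
    fix b assume b: "b \<in> B"
    then have "|f b| <o \<mu>"
      using f AB unfolding set_mapping_def bipartition_def by blast
    then have "|f b| <o |nbrs H b \<inter> A|"
      using deg b ordLess_ordLeq_trans by blast
    then obtain a where a: "a \<in> nbrs H b" "a \<in> A" "a \<notin> f b"
      using card_of_mono1[of "nbrs H b \<inter> A" "f b"] not_ordLess_ordLeq by blast
    then have "b \<in> f a"
      using f unfolding set_mapping_def nbrs_def by blast
    then show "b \<in> (\<Union>a\<in>A. f a)"
      using a by blast
  qed
  moreover have "|\<Union>a\<in>A. f a| \<le>o \<theta>"
  proof (rule card_of_UNION_ordLeq_infinite_Field[OF inf \<theta>(1) ordIso_imp_ordLeq[OF A]], rule)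
    fix a assume "a \<in> A"
    then have "|f a| <o \<mu>"
      using f AB unfolding set_mapping_def bipartition_def by blast
    then show "|f a| \<le>o \<theta>"
      using \<theta>(2) ordLess_ordLeq_trans ordLess_imp_ordLeq by blast
  qed
  ultimately have "|B| \<le>o \<theta>"
    using card_of_mono1 ordLeq_transitive by blast
  then have "cardSuc \<theta> \<le>o \<theta>"
    using B ordIso_symmetric ordIso_ordLeq_trans by blast
  then show False
    using cardSuc_greater[OF \<theta>(1)] not_ordLess_ordLeq by blast
qed

text \<open>By regularity some \<open>h x\<close> bounds \<open>f x\<close> strictly. Let \<alpha>
  in \<open>T_set\<close> be closed under \<open>h\<close>. It has \<mu> neighbours below it, so one
  of them, \<beta>, is missing from \<open>f \<alpha>\<close>; then \<alpha> lies in
  \<open>f \<beta>\<close>, which is bounded below \<alpha>.\<close>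

lemma standard_obstruction_II_no_set_mapping:
  assumes \<mu>: "Card_order \<mu>" "infinite (Field \<mu>)"
    and II: "standard_obstruction_II \<mu> \<kappa> H"
  shows "\<not> set_mapping \<mu> H f"
proof
  assume f: "set_mapping \<mu> H f"
  have \<kappa>: "Card_order \<kappa>" "\<mu> <o \<kappa>" "regularCard \<kappa>" and H: "simple_graph H" "verts H = Field \<kappa>"
    and st: "stationary \<kappa> (T_set \<mu> \<kappa> H)"
    using II unfolding standard_obstruction_II_def by blast+
  have wo: "Well_order \<kappa>"
    using \<kappa>(1) by (simp add: card_order_on_def)
  have inf: "infinite (Field \<kappa>)"
    using infinite_Field_ordLeq[OF \<mu>(2) ordLess_imp_ordLeq[OF \<kappa>(2)]] .
  have "\<exists>b\<in>Field \<kappa>. f x \<inter> Field \<kappa> \<subseteq> underS \<kappa> b" if "x \<in> Field \<kappa>" for x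
  proof -
    have "|f x| <o \<kappa>"
      using f H(2) that \<kappa>(2) ordLess_transitive unfolding set_mapping_def by blast
    then have "|f x \<inter> Field \<kappa>| <o \<kappa>"
      using card_of_mono1[of "f x \<inter> Field \<kappa>" "f x"] ordLeq_ordLess_trans by blast
    then show ?thesis
      using regular_bounded[OF \<kappa>(1) inf \<kappa>(3), of "f x \<inter> Field \<kappa>"] by blast
  qed
  then obtain h where h: "\<And>x. x \<in> Field \<kappa> \<Longrightarrow> h x \<in> Field \<kappa>"
    "\<And>x. x \<in> Field \<kappa> \<Longrightarrow> f x \<inter> Field \<kappa> \<subseteq> underS \<kappa> (h x)"
    by metis
  have "club \<kappa> (closure_points \<kappa> h)"
    using club_closure_points[OF \<kappa>(1) natLeq_ordLess[OF \<mu> \<kappa>(2)] \<kappa>(3)] h(1) by blast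
  then obtain \<alpha> where \<alpha>: "\<alpha> \<in> T_set \<mu> \<kappa> H" "\<alpha> \<in> closure_points \<kappa> h"
    using st unfolding stationary_def by blast
  let ?N = "nbrs H \<alpha> \<inter> underS \<kappa> \<alpha>"
  have \<alpha>F: "\<alpha> \<in> Field \<kappa>" and N: "Restr \<kappa> ?N =o \<mu>"
    using \<alpha>(1) unfolding T_set_def by blast+
  have "Field (Restr \<kappa> ?N) = ?N"
    using Refl_Field_Restr2[of \<kappa> ?N] wo in_Field_underS[of _ \<kappa> \<alpha>]
    by (auto simp: order_on_defs)
  then have "|?N| =o \<mu>"
    using card_of_cong[OF N] card_of_Field_ordIso[OF \<mu>(1)] ordIso_transitive by metis
  moreover have "|f \<alpha>| <o \<mu>"
    using f H(2) \<alpha>F unfolding set_mapping_def by blast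
  ultimately have "|f \<alpha>| <o |?N|"
    using ordIso_symmetric ordLess_ordIso_trans by blast
  then obtain \<beta> where \<beta>: "\<beta> \<in> nbrs H \<alpha>" "\<beta> \<in> underS \<kappa> \<alpha>" "\<beta> \<notin> f \<alpha>"
    using card_of_mono1[of ?N "f \<alpha>"] not_ordLess_ordLeq by blast
  then have "\<alpha> \<in> f \<beta>"
    using f unfolding set_mapping_def nbrs_def by blast
  then have "\<alpha> \<in> underS \<kappa> (h \<beta>)"
    using h(2)[of \<beta>] \<beta>(2) in_Field_underS[OF \<beta>(2)] by blast
  moreover have "h \<beta> \<in> underS \<kappa> \<alpha>"
    using \<alpha>(2) \<beta>(2) unfolding closure_points_def by blast
  ultimately show False
    using underS_asym[OF wo] by blast
qed

lemma obstruction_imp_not_col_bound: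
  fixes G H :: "'a ugraph"
  assumes \<mu>: "Card_order \<mu>" "infinite (Field \<mu>)" and "simple_graph G"
    and "subgraph H G" "obstruction_I \<mu> H \<or> obstruction_II \<mu> H"
  shows "\<not> col_bound G \<mu>"
proof
  assume "col_bound G \<mu>"
  then obtain f where f: "set_mapping \<mu> H f"
    using col_bound_imp_set_mapping assms set_mapping_subgraph by blast
  then have "obstruction_II \<mu> H"
    using obstruction_I_no_set_mapping[OF \<mu>] assms(5) by blast
  then obtain \<kappa> :: "'a rel" and H' :: "'a ugraph" where "standard_obstruction_II \<mu> \<kappa> H'" "graph_iso H H'"
    unfolding obstruction_II_def by blast
  then show False
    using standard_obstruction_II_no_set_mapping[OF \<mu>] set_mapping_iso[OF _ _ f]
    unfolding standard_obstruction_II_def by blast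
qed

section \<open>Order types and cofinalities\<close>

text \<open>Least elements of singletons and pairs already give reflexivity and totality, so these
  need no check for the composite orders built later.\<close>

lemma well_order_onI:
  assumes "s \<subseteq> W \<times> W" "antisym s" "trans s"
    and least: "\<And>S. S \<subseteq> W \<Longrightarrow> S \<noteq> {} \<Longrightarrow> \<exists>m\<in>S. \<forall>x\<in>S. (m, x) \<in> s"
  shows "well_order_on W s"
proof -
  have "refl_on W s"
    unfolding refl_on_def using least[of "{x}" for x] by auto
  moreover have "total_on W s"
    unfolding total_on_def
  proof (intro ballI impI)
    fix x y assume "x \<in> W" "y \<in> W"
    then show "(x, y) \<in> s \<or> (y, x) \<in> s"
      using least[of "{x, y}"] by auto
  qed
  moreover have "wf (s - Id)"
    unfolding wf_eq_minimal
  proof (intro allI impI)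
    fix Q :: "'a set" and x assume x: "x \<in> Q"
    show "\<exists>z\<in>Q. \<forall>y. (y, z) \<in> s - Id \<longrightarrow> y \<notin> Q"
    proof (cases "Q \<inter> W = {}")
      case True
      then show ?thesis
        using x assms(1) by blast
    next
      case False
      then obtain m where "m \<in> Q \<inter> W" "\<forall>x\<in>Q \<inter> W. (m, x) \<in> s"
        using least[of "Q \<inter> W"] by blast
      then show ?thesis
        using assms(1,2) unfolding antisym_def by blast
    qed
  qed
  ultimately show ?thesis
    using assms(1-3) by (simp add: order_on_defs)
qed

text \<open>A proper segment of type at least \<mu> would have at least \<mu> points; hence all are
  shorter and \<open>s \<le>o \<mu>\<close>. This turns counting into an order type.\<close>

lemma ordIso_if_small_segments:
  assumes s: "Well_order s" and \<mu>: "Card_order \<mu>" "\<mu> \<le>o |Field s|"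
    and seg: "\<And>a. a \<in> Field s \<Longrightarrow> |underS s a| <o \<mu>"
  shows "s =o \<mu>"
proof -
  have wo: "Well_order \<mu>"
    using \<mu>(1) by (simp add: card_order_on_def)
  have "Restr s (underS s a) <o \<mu>" if a: "a \<in> Field s" for a
  proof (rule ccontr)
    assume "\<not> Restr s (underS s a) <o \<mu>"
    then have "\<mu> \<le>o Restr s (underS s a)"
      using not_ordLess_iff_ordLeq[OF wo Well_order_Restr[OF s]] by blast
    then have "|Field \<mu>| \<le>o |Field (Restr s (underS s a))|"
      by (rule card_of_mono2)
    also have "|Field (Restr s (underS s a))| \<le>o |underS s a|"
      by (rule card_of_mono1[OF Field_Restr_subset])
    also have "|underS s a| <o \<mu>"
      by (rule seg[OF a])
    finally show False
      using card_of_Field_ordIso[OF \<mu>(1)] not_ordLess_ordIso by blast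
  qed
  then have "s \<le>o \<mu>"
    using ordLeq_iff_ordLess_Restr[OF s wo] by blast
  moreover have "\<mu> \<le>o s"
    using ordLeq_transitive[OF \<mu>(2) card_of_least[OF s]] .
  ultimately show ?thesis
    using ordIso_iff_ordLeq by blast
qed

lemma cf_ordIso_ordLeq:
  assumes "r =o r'"
  shows "cf r' \<le>o cf r"
proof -
  obtain f where f: "Well_order r" "Well_order r'" "embed r r' f" "bij_betw f (Field r) (Field r')"
    using assms unfolding ordIso_def iso_def by blast
  have c: "(f a, f b) \<in> r'" if "(a, b) \<in> r" for a b
    using embed_compat[OF f(3)] that unfolding compat_def by blast
  obtain K where K: "K \<subseteq> Field r" "\<forall>a\<in>Field r. \<exists>b\<in>K. (a, b) \<in> r" "cf r = |K|"
    using cf_witness[OF f(1)] by blast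
  have "cf r' \<le>o |f ` K|"
  proof (rule cf_least)
    show "f ` K \<subseteq> Field r'"
      using K(1) f(4) unfolding bij_betw_def by blast
    show "\<forall>a\<in>Field r'. \<exists>b\<in>f ` K. (a, b) \<in> r'"
    proof
      fix a' assume "a' \<in> Field r'"
      then obtain a where "a \<in> Field r" "a' = f a"
        using f(4) unfolding bij_betw_def by blast
      then show "\<exists>b\<in>f ` K. (a', b) \<in> r'"
        using K(2) c by blast
    qed
  qed
  then show ?thesis
    unfolding K(3) by (rule ordLeq_transitive[OF _ card_of_image])
qed

lemma cf_ordIso: "r =o r' \<Longrightarrow> cf r =o cf r'"
  by (simp add: cf_ordIso_ordLeq ordIso_iff_ordLeq)

lemma cf_Restr_cofinal:
  assumes r: "Well_order r" and "N \<subseteq> S" "S \<subseteq> Field r"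
    and cof: "\<And>a. a \<in> S \<Longrightarrow> \<exists>b\<in>N. (a, b) \<in> r"
  shows "cf (Restr r S) =o cf (Restr r N)"
proof -
  have F: "Field (Restr r X) = X" if "X \<subseteq> S" for X
    using Refl_Field_Restr2[of r X] r that assms(3) by (auto simp: order_on_defs)
  have tr: "(a, c) \<in> r" if "(a, b) \<in> r" "(b, c) \<in> r" for a b c
    using r that wo_rel.TRANS[of r] unfolding wo_rel_def trans_def by blast
  obtain K where K: "K \<subseteq> N" "\<forall>a\<in>N. \<exists>b\<in>K. (a, b) \<in> Restr r N" "cf (Restr r N) = |K|"
    using cf_witness[OF Well_order_Restr[OF r, of N]] F assms(2) by auto
  have "cf (Restr r S) \<le>o |K|"
  proof (rule cf_least)
    show "K \<subseteq> Field (Restr r S)"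
      using K(1) F assms(2) by auto
    show "\<forall>a\<in>Field (Restr r S). \<exists>b\<in>K. (a, b) \<in> Restr r S"
    proof
      fix a assume "a \<in> Field (Restr r S)"
      then have a: "a \<in> S"
        using F by auto
      obtain b where b: "b \<in> N" "(a, b) \<in> r"
        using cof[OF a] by blast
      then obtain c where "c \<in> K" "(b, c) \<in> r"
        using K(2) by blast
      then show "\<exists>b\<in>K. (a, b) \<in> Restr r S"
        using tr[OF b(2)] a K(1) assms(2) by blast
    qed
  qed
  moreover
  obtain L where L: "L \<subseteq> S" "\<forall>a\<in>S. \<exists>b\<in>L. (a, b) \<in> Restr r S" "cf (Restr r S) = |L|"
    using cf_witness[OF Well_order_Restr[OF r, of S]] F by auto
  obtain g where g: "\<And>a. a \<in> S \<Longrightarrow> g a \<in> N \<and> (a, g a) \<in> r"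
    using cof by metis
  have "cf (Restr r N) \<le>o |g ` L|"
  proof (rule cf_least)
    show "g ` L \<subseteq> Field (Restr r N)"
      using L(1) F assms(2) g by auto
    show "\<forall>a\<in>Field (Restr r N). \<exists>b\<in>g ` L. (a, b) \<in> Restr r N"
    proof
      fix a assume "a \<in> Field (Restr r N)"
      then have a: "a \<in> N"
        using F assms(2) by auto
      then obtain c where c: "c \<in> L" "(a, c) \<in> r"
        using L(2) assms(2) by blast
      then show "\<exists>b\<in>g ` L. (a, b) \<in> Restr r N"
        using tr[OF c(2)] g L(1) a by blast
    qed
  qed
  then have "cf (Restr r N) \<le>o |L|"
    by (rule ordLeq_transitive[OF _ card_of_image])
  ultimately show ?thesis
    unfolding K(3) L(3) by (simp add: ordIso_iff_ordLeq)
qed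

text \<open>The cofinality clause is automatic: the neighbours are cofinal below \<alpha> and have
  type \<mu>.\<close>

lemma T_setI:
  assumes wo: "Well_order \<kappa>" and \<alpha>: "\<alpha> \<in> Field \<kappa>"
    and iso: "Restr \<kappa> (nbrs H \<alpha> \<inter> underS \<kappa> \<alpha>) =o \<mu>"
    and cof: "\<And>x. x \<in> underS \<kappa> \<alpha> \<Longrightarrow> \<exists>a\<in>nbrs H \<alpha> \<inter> underS \<kappa> \<alpha>. x \<in> underS \<kappa> a"
  shows "\<alpha> \<in> T_set \<mu> \<kappa> H"
proof -
  have "cf (Restr \<kappa> (underS \<kappa> \<alpha>)) =o cf (Restr \<kappa> (nbrs H \<alpha> \<inter> underS \<kappa> \<alpha>))"
  proof (rule cf_Restr_cofinal[OF wo])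
    show "underS \<kappa> \<alpha> \<subseteq> Field \<kappa>"
      using in_Field_underS by fast
    show "\<exists>b\<in>nbrs H \<alpha> \<inter> underS \<kappa> \<alpha>. (x, b) \<in> \<kappa>" if "x \<in> underS \<kappa> \<alpha>" for x
      using cof[OF that] unfolding underS_def by blast
  qed blast
  then have "cf (Restr \<kappa> (underS \<kappa> \<alpha>)) =o cf \<mu>"
    using cf_ordIso[OF iso] by (rule ordIso_transitive)
  moreover have "wo_rel.supr \<kappa> (nbrs H \<alpha> \<inter> underS \<kappa> \<alpha>) = \<alpha>"
    using supr_eqI[OF wo _ \<alpha> cof] by blast
  ultimately show ?thesis
    using \<alpha> iso unfolding T_set_def by blast
qed

section \<open>Graphs without type I obstructions\<close>

text \<open>A member outside X must not come after all of X in the desired well-order.\<close>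

definition rich :: "'m rel \<Rightarrow> 'a ugraph \<Rightarrow> 'a set \<Rightarrow> 'a set" where
  "rich \<mu> G X = {v \<in> verts G. \<mu> \<le>o |nbrs G v \<inter> X|}"

lemma cardSuc_Diff:
  assumes \<theta>: "Card_order \<theta>" "infinite (Field \<theta>)"
    and S: "|S| =o cardSuc \<theta>" and N: "|N| \<le>o \<theta>"
  shows "|S - N| =o cardSuc \<theta>"
proof -
  have wo: "Well_order (cardSuc \<theta>)"
    using cardSuc_Well_order[OF \<theta>(1)] .
  have "\<not> |S - N| <o cardSuc \<theta>"
  proof
    assume "|S - N| <o cardSuc \<theta>"
    then have "|S - N| \<le>o \<theta>"
      using cardSuc_ordLeq_ordLess[OF \<theta>(1) card_of_Card_order] by blast
    then have "|(S - N) \<union> N| \<le>o \<theta>"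
      using card_of_Un_ordLeq_infinite_Field[OF \<theta>(2) _ N \<theta>(1)] by blast
    moreover have "|S| \<le>o |(S - N) \<union> N|"
      by (rule card_of_mono1) blast
    ultimately have "|S| \<le>o \<theta>"
      by (metis ordLeq_transitive)
    then have "cardSuc \<theta> \<le>o \<theta>"
      by (rule ordIso_ordLeq_trans[OF ordIso_symmetric[OF S]])
    then show False
      using cardSuc_greater[OF \<theta>(1)] not_ordLess_ordLeq by blast
  qed
  then have "cardSuc \<theta> \<le>o |S - N|"
    using not_ordLess_iff_ordLeq[OF wo card_of_Well_order] by blast
  moreover have "|S - N| \<le>o cardSuc \<theta>"
    by (rule ordLeq_ordIso_trans[OF card_of_mono1 S]) blast
  ultimately show ?thesis
    by (simp add: ordIso_iff_ordLeq)
qed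

text \<open>A counterexample \<open>X\<close> of least cardinality yields an obstruction: after the vertices of \<open>X\<close>
  with few neighbours in \<open>B\<close> and all their neighbours have been deleted, minimality forces the
  remaining part of \<open>X\<close> to have full cardinality.\<close>

lemma card_rich_ordLeq:
  fixes G :: "'a ugraph"
  assumes \<mu>: "Card_order \<mu>" "infinite (Field \<mu>)" and G: "simple_graph G"
    and noI: "\<And>H. subgraph H G \<Longrightarrow> \<not> obstruction_I \<mu> H"
    and "X \<subseteq> verts G" "\<mu> \<le>o |X|"
  shows "|rich \<mu> G X| \<le>o |X|"
proof (rule ccontr)
  define Bad where "Bad = {X. X \<subseteq> verts G \<and> \<mu> \<le>o |X| \<and> |X| <o |rich \<mu> G X|}"
  assume "\<not> |rich \<mu> G X| \<le>o |X|"
  then have "X \<in> Bad"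
    using assms(5,6) unfolding Bad_def not_card_ordLeq_iff by blast
  then have "\<exists>r\<in>card_of ` Bad. \<forall>r'\<in>card_of ` Bad. r \<le>o r'"
    by (intro exists_minim_Card_order) (auto simp: card_of_Card_order)
  then obtain X where X: "X \<subseteq> verts G" "\<mu> \<le>o |X|" "|X| <o |rich \<mu> G X|"
    and min: "\<And>Y. Y \<in> Bad \<Longrightarrow> |X| \<le>o |Y|"
    unfolding Bad_def by blast
  let ?\<theta> = "|X|"
  have \<theta>: "Card_order ?\<theta>" "infinite (Field ?\<theta>)"
    using card_of_Card_order infinite_Field_ordLeq[OF \<mu>(2) X(2)] by auto
  \<comment> \<open>Removing X leaves more than |X| vertices and makes the sides of the future
    bipartition disjoint.\<close>
  define B0 where "B0 = rich \<mu> G X - X"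
  have "|X| <o |B0|"
  proof (rule ccontr)
    assume "\<not> |X| <o |B0|"
    then have "|B0| \<le>o |X|"
      using not_card_ordLeq_iff by blast
    then have "|B0 \<union> X| \<le>o |X|"
      using card_of_Un_ordLeq_infinite_Field[OF \<theta>(2) _ ordLeq_reflexive[OF card_of_Well_order] \<theta>(1)]
      by blast
    moreover have "|rich \<mu> G X| \<le>o |B0 \<union> X|"
      unfolding B0_def by (rule card_of_mono1) blast
    ultimately have "|rich \<mu> G X| \<le>o |X|"
      by (metis ordLeq_transitive)
    then show False
      using X(3) not_ordLess_ordLeq by blast
  qed
  then have "cardSuc ?\<theta> \<le>o |B0|"
    using cardSuc_ordLess_ordLeq[OF \<theta>(1) card_of_Card_order] by blast
  then obtain B where B: "B \<subseteq> B0" and cB: "|B| =o cardSuc ?\<theta>"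
    by (rule card_ordLeq_obtain_subset[OF cardSuc_Card_order[OF \<theta>(1)]])
  \<comment> \<open>At most |X| vertices with at most |X| neighbours in \<open>B\<close> each:
    deleting their neighbours \<open>N\<close> keeps the full successor size both of
    \<open>B\<close> and of the neighbourhood in \<open>B\<close> of each vertex of
    \<open>A1\<close>. No vertex of \<open>B1\<close> has a neighbour in \<open>A'\<close>.\<close>
  define A' where "A' = {a \<in> X. |nbrs G a \<inter> B| \<le>o ?\<theta>}"
  define N where "N = (\<Union>a\<in>A'. nbrs G a \<inter> B)"
  define A1 where "A1 = X - A'"
  define B1 where "B1 = B - N"
  have "|A'| \<le>o |X|"
    unfolding A'_def by (rule card_of_mono1) blast
  then have N: "|N| \<le>o ?\<theta>"
    unfolding N_def using \<theta>(2)
    by (intro card_of_UNION_ordLeq_infinite) (auto simp: A'_def Field_card_of)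
  have cB1: "|B1| =o cardSuc ?\<theta>"
    unfolding B1_def by (rule cardSuc_Diff[OF \<theta> cB N])
  have sym: "(u, v) \<in> edges G \<longleftrightarrow> (v, u) \<in> edges G" for u v
    using G unfolding simple_graph_def sym_def by blast
  have nb: "nbrs G b \<inter> X = nbrs G b \<inter> A1" if "b \<in> B1" for b
    using that sym unfolding A1_def B1_def N_def nbrs_def by blast
  have rich1: "b \<in> verts G" "\<mu> \<le>o |nbrs G b \<inter> A1|" if "b \<in> B1" for b
  proof -
    have "b \<in> rich \<mu> G X"
      using that B unfolding B1_def B0_def by blast
    then show "b \<in> verts G" "\<mu> \<le>o |nbrs G b \<inter> A1|"
      unfolding rich_def using nb[OF that] by auto
  qed
  have "\<not> |B1| \<le>o |X|"
    using ordIso_ordLeq_trans[OF ordIso_symmetric[OF cB1]] cardSuc_greater[OF \<theta>(1)]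
      not_ordLess_ordLeq by blast
  then have XB1: "|X| <o |B1|"
    using not_card_ordLeq_iff by blast
  then have "B1 \<noteq> {}"
    using card_of_empty not_ordLess_ordLeq by blast
  then obtain b where b: "b \<in> B1"
    by blast
  have A1X: "|A1| \<le>o |X|"
    unfolding A1_def by (rule card_of_mono1) blast
  have "\<mu> \<le>o |A1|"
    by (rule ordLeq_transitive[OF rich1(2)[OF b] card_of_mono1]) blast
  moreover have "|B1| \<le>o |rich \<mu> G A1|"
    by (rule card_of_mono1) (use rich1 in \<open>auto simp: rich_def\<close>)
  then have "|A1| <o |rich \<mu> G A1|"
    by (metis A1X XB1 ordLeq_ordLess_trans ordLess_ordLeq_trans)
  ultimately have "A1 \<in> Bad"
    using X(1) unfolding Bad_def A1_def by blast
  then have cA1: "|A1| =o ?\<theta>"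
    using min A1X by (simp add: ordIso_iff_ordLeq)
  define H where "H = \<lparr>verts = A1 \<union> B1,
    edges = {(u, v) \<in> edges G. u \<in> A1 \<and> v \<in> B1 \<or> u \<in> B1 \<and> v \<in> A1}\<rparr>"
  have H: "verts H = A1 \<union> B1"
    "edges H = {(u, v) \<in> edges G. u \<in> A1 \<and> v \<in> B1 \<or> u \<in> B1 \<and> v \<in> A1}"
    by (simp_all add: H_def)
  have disj: "A1 \<inter> B1 = {}"
    using B unfolding A1_def B1_def B0_def by blast
  have "simple_graph H"
    using G unfolding simple_graph_def H by (auto simp: sym_def irrefl_def)
  moreover have "bipartition H A1 B1"
    unfolding bipartition_def H using disj by auto
  moreover have "nbrs H b \<inter> A1 = nbrs G b \<inter> A1" if "b \<in> B1" for b
    using that unfolding nbrs_def H by auto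
  moreover have "|nbrs H a \<inter> B1| =o cardSuc ?\<theta>" if a: "a \<in> A1" for a
  proof -
    have "\<not> |nbrs G a \<inter> B| \<le>o |X|"
      using a unfolding A1_def A'_def by blast
    then have "cardSuc ?\<theta> \<le>o |nbrs G a \<inter> B|"
      using cardSuc_ordLess_ordLeq[OF \<theta>(1) card_of_Card_order] not_card_ordLeq_iff by blast
    moreover have "|nbrs G a \<inter> B| \<le>o cardSuc ?\<theta>"
      by (rule ordLeq_ordIso_trans[OF card_of_mono1 cB]) blast
    ultimately have "|nbrs G a \<inter> B| =o cardSuc ?\<theta>"
      by (simp add: ordIso_iff_ordLeq)
    then have "|nbrs G a \<inter> B - N| =o cardSuc ?\<theta>"
      by (rule cardSuc_Diff[OF \<theta> _ N])
    moreover have "nbrs H a \<inter> B1 = nbrs G a \<inter> B - N"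
      using a unfolding nbrs_def H B1_def by auto
    ultimately show ?thesis
      by simp
  qed
  ultimately have "obstruction_I \<mu> H"
    unfolding obstruction_I_def using cA1 cB1 \<theta>(1) X(2) rich1(2) by metis
  moreover have "subgraph H G"
    using \<open>simple_graph H\<close> X(1) rich1(1) unfolding subgraph_def H A1_def by auto
  ultimately show False
    using noI by blast
qed

section \<open>Gluing well-orders\<close>

definition induced :: "'a ugraph \<Rightarrow> 'a set \<Rightarrow> 'a ugraph" where
  "induced G W = \<lparr>verts = W, edges = edges G \<inter> W \<times> W\<rparr>"

lemma induced_simps [simp]: "verts (induced G W) = W"
  "v \<in> W \<Longrightarrow> nbrs (induced G W) v = nbrs G v \<inter> W"
  unfolding induced_def nbrs_def by auto

lemma simple_graph_induced: "simple_graph G \<Longrightarrow> simple_graph (induced G W)"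
  unfolding simple_graph_def induced_def sym_def irrefl_def by auto

text \<open>Each vertex v goes to the first piece \<open>\<rho> v\<close> containing it; vertices
  are compared by piece, then by the order inside the piece. Earlier neighbours of v lie in earlier
  pieces, where \<open>sparse\<close> applies since v avoids those, or in its own piece. The pieces
  may overlap.\<close>

lemma col_bound_glue:
  fixes r :: "'i rel"
  assumes \<mu>: "Card_order \<mu>" "infinite (Field \<mu>)"
    and r: "Well_order r" "J \<subseteq> Field r" and W: "W = (\<Union>j\<in>J. Y j)"
    and piece: "\<And>j. j \<in> J \<Longrightarrow> col_bound (induced G (Y j)) \<mu>"
    and sparse: "\<And>i v. i \<in> J \<Longrightarrow> v \<in> W \<Longrightarrow> v \<notin> (\<Union>j\<in>J \<inter> underS r i. Y j) \<Longrightarrow>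
      |nbrs G v \<inter> (\<Union>j\<in>J \<inter> underS r i. Y j)| <o \<mu>"
  shows "col_bound (induced G W) \<mu>"
proof -
  have "\<exists>j\<in>J. v \<in> Y j \<and> (\<forall>i\<in>J. v \<in> Y i \<longrightarrow> i \<notin> underS r j)" if "v \<in> W" for v
  proof -
    have "{j \<in> J. v \<in> Y j} \<noteq> {}" "{j \<in> J. v \<in> Y j} \<subseteq> Field r"
      using that W r(2) by auto
    then show ?thesis
      using Well_order_least[OF r(1)] by (metis (no_types, lifting) mem_Collect_eq)
  qed
  then obtain \<rho> where \<rho>: "\<And>v. v \<in> W \<Longrightarrow> \<rho> v \<in> J" "\<And>v. v \<in> W \<Longrightarrow> v \<in> Y (\<rho> v)"
    "\<And>v i. v \<in> W \<Longrightarrow> i \<in> J \<Longrightarrow> v \<in> Y i \<Longrightarrow> i \<notin> underS r (\<rho> v)"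
    by metis
  have "\<exists>t. well_order_on (Y j) t \<and> (\<forall>v\<in>Y j. |nbrs (induced G (Y j)) v \<inter> underS t v| <o \<mu>)"
    if "j \<in> J" for j
    using piece[OF that] unfolding col_bound_def by simp
  then obtain t where t: "\<And>j. j \<in> J \<Longrightarrow> well_order_on (Y j) (t j)"
    "\<And>j v. j \<in> J \<Longrightarrow> v \<in> Y j \<Longrightarrow> |nbrs (induced G (Y j)) v \<inter> underS (t j) v| <o \<mu>"
    by metis
  have tF: "Field (t j) = Y j" "Well_order (t j)" if "j \<in> J" for j
    using well_order_on_Well_order[OF t(1)[OF that]] by auto
  define s where "s = {(v, w). v \<in> W \<and> w \<in> W \<and>
    (\<rho> v \<in> underS r (\<rho> w) \<or> \<rho> v = \<rho> w \<and> (v, w) \<in> t (\<rho> v))}"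
  have "well_order_on W s"
  proof (rule well_order_onI)
    show "s \<subseteq> W \<times> W"
      unfolding s_def by blast
    show "antisym s"
    proof (rule antisymI)
      fix v w assume "(v, w) \<in> s" "(w, v) \<in> s"
      then have "v \<in> W" "(v, w) \<in> t (\<rho> v)" "(w, v) \<in> t (\<rho> v)"
        using underS_asym[OF r(1)] underS_notIn unfolding s_def by fastforce+
      then show "v = w"
        using tF(2)[OF \<rho>(1)] wo_rel.ANTISYM unfolding wo_rel_def antisym_def by blast
    qed
    show "trans s"
    proof (rule transI)
      fix u v w assume *: "(u, v) \<in> s" "(v, w) \<in> s"
      then have "u \<in> W" "trans (t (\<rho> u))"
        using tF(2)[OF \<rho>(1)] wo_rel.TRANS unfolding wo_rel_def s_def by blast+
      then show "(u, w) \<in> s"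
        using * underS_trans[OF r(1)] unfolding s_def trans_def by auto
    qed
    fix S assume S: "S \<subseteq> W" "S \<noteq> {}"
    then have "\<rho> ` S \<subseteq> Field r" "\<rho> ` S \<noteq> {}"
      using \<rho>(1) r(2) by auto
    then obtain j where j: "j \<in> \<rho> ` S" "\<And>i. i \<in> \<rho> ` S \<Longrightarrow> i \<notin> underS r j"
      using Well_order_least[OF r(1)] by metis
    then have jJ: "j \<in> J"
      using S(1) \<rho>(1) by blast
    have sub: "{v \<in> S. \<rho> v = j} \<subseteq> Field (t j)"
      unfolding tF(1)[OF jJ] using \<rho>(2) S(1) by blast
    have ne: "{v \<in> S. \<rho> v = j} \<noteq> {}"
      using j(1) by auto
    obtain m where m: "m \<in> {v \<in> S. \<rho> v = j}" "\<And>v. v \<in> {v \<in> S. \<rho> v = j} \<Longrightarrow> v \<notin> underS (t j) m"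
      using Well_order_least[OF tF(2)[OF jJ] sub ne] by metis
    have "(m, v) \<in> s" if v: "v \<in> S" for v
    proof (cases "\<rho> v = j")
      case True
      then have "(m, v) \<in> t j"
        using le_iff_not_underS[OF tF(2)[OF jJ], of m v] m v sub by blast
      then show ?thesis
        using True m v S(1) unfolding s_def by auto
    next
      case False
      then have "j \<in> underS r (\<rho> v)"
        using underS_linear[OF r(1), of j "\<rho> v"] j(2)[of "\<rho> v"] v jJ r(2) \<rho>(1) S(1) by blast
      then show ?thesis
        using m v S(1) unfolding s_def by auto
    qed
    then show "\<exists>m\<in>S. \<forall>x\<in>S. (m, x) \<in> s"
      using m by blast
  qed
  moreover have "|nbrs (induced G W) v \<inter> underS s v| <o \<mu>" if v: "v \<in> W" for v
  proof -
    let ?Z = "\<Union>j\<in>J \<inter> underS r (\<rho> v). Y j"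
    have "v \<notin> ?Z"
      using \<rho>(3)[OF v] by blast
    then have 1: "|nbrs G v \<inter> ?Z| <o \<mu>"
      using sparse[OF \<rho>(1)[OF v] v] by blast
    have 2: "|nbrs (induced G (Y (\<rho> v))) v \<inter> underS (t (\<rho> v)) v| <o \<mu>"
      using t(2)[OF \<rho>(1)[OF v] \<rho>(2)[OF v]] .
    have "nbrs (induced G W) v \<inter> underS s v \<subseteq>
      (nbrs G v \<inter> ?Z) \<union> (nbrs (induced G (Y (\<rho> v))) v \<inter> underS (t (\<rho> v)) v)"
    proof
      fix u assume u: "u \<in> nbrs (induced G W) v \<inter> underS s v"
      then have "u \<in> nbrs G v" "u \<in> W" "u \<noteq> v"
        using v unfolding underS_def by auto
      moreover have "\<rho> u \<in> underS r (\<rho> v) \<or> \<rho> u = \<rho> v \<and> (u, v) \<in> t (\<rho> v)"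
        using u unfolding s_def underS_def by auto
      ultimately show "u \<in> (nbrs G v \<inter> ?Z) \<union> (nbrs (induced G (Y (\<rho> v))) v \<inter> underS (t (\<rho> v)) v)"
        using \<rho>(1,2)[of u] \<rho>(2)[OF v] unfolding underS_def by auto
    qed
    then show ?thesis
      using card_of_Un_ordLess_infinite_Field[OF \<mu>(2,1) 1 2] card_of_mono1 ordLeq_ordLess_trans
      by (metis (no_types, lifting))
  qed
  ultimately show ?thesis
    unfolding col_bound_def by auto
qed

section \<open>Singular cardinals\<close>

text \<open>From a cofinal set \<open>K\<close> of fewer than \<open>r\<close> points, drop those
  below some \<open>t\<close> that already has |M| + |K| points beneath it. The rest is still
  cofinal and cuts off only large segments. Later \<open>M\<close> indexes the rounds of the
  closing-off.\<close>

lemma singular_cofinal_set: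
  assumes r: "Card_order r" "infinite (Field r)" "\<not> regularCard r" and M: "|M| <o r"
  obtains J where "J \<subseteq> Field r" "Field r = (\<Union>j\<in>J. underS r j)"
    "\<And>j. j \<in> J \<Longrightarrow> |J| \<le>o |underS r j|" "\<And>j. j \<in> J \<Longrightarrow> |M| \<le>o |underS r j|"
proof -
  have wo: "Well_order r"
    using r(1) by (simp add: card_order_on_def)
  obtain K where K: "K \<subseteq> Field r" "cofinal K r" "\<not> |K| =o r"
    using r(3) unfolding regularCard_def by blast
  have "|K| <o r"
    using ordLeq_ordIso_trans[OF card_of_mono1[OF K(1)] card_of_Field_ordIso[OF r(1)]] K(3)
    by (simp add: ordLeq_iff_ordLess_or_ordIso)
  then have "|M <+> K| <o r"
    using card_of_Plus_ordLess_infinite_Field[OF r(2,1) M] by blast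
  then obtain t where t: "t \<in> Field r" "|M <+> K| =o Restr r (underS r t)"
    using ordLess_iff_ordIso_Restr[OF wo card_of_Well_order] by blast
  have "|Field |M <+> K| | =o |Field (Restr r (underS r t))|"
    by (rule card_of_cong[OF t(2)])
  moreover have "Field (Restr r (underS r t)) \<subseteq> underS r t"
    by (rule Field_Restr_subset)
  ultimately have big: "|M <+> K| \<le>o |underS r t|"
    using ordIso_ordLeq_trans card_of_mono1 by (metis Field_card_of)
  define J where "J = {k \<in> K. k \<notin> underS r t}"
  have sub: "underS r t \<subseteq> underS r j" if "j \<in> J" for j
    using that K(1) le_iff_not_underS[OF wo t(1)] underS_subset[OF wo] unfolding J_def by blast
  have up: "|M <+> K| \<le>o |underS r j|" if "j \<in> J" for j
    by (rule ordLeq_transitive[OF big card_of_mono1[OF sub[OF that]]])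
  show ?thesis
  proof (rule that)
    show "J \<subseteq> Field r"
      using K(1) unfolding J_def by blast
    show "Field r = (\<Union>j\<in>J. underS r j)"
    proof
      show "Field r \<subseteq> (\<Union>j\<in>J. underS r j)"
      proof
        fix w assume "w \<in> Field r"
        then obtain k where k: "k \<in> K" "w \<in> underS r k"
          using K(2) unfolding cofinal_def underS_def by blast
        obtain k' where k': "k' \<in> K" "t \<in> underS r k'"
          using K(2) t(1) unfolding cofinal_def underS_def by blast
        then have "k' \<in> J"
          using underS_asym[OF wo] unfolding J_def by blast
        show "w \<in> (\<Union>j\<in>J. underS r j)"
        proof (cases "k \<in> J")
          case False
          then have "k \<in> underS r t"
            using k(1) unfolding J_def by blast
          then have "w \<in> underS r k'"
            using underS_trans[OF wo] k(2) k'(2) by blast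
          then show ?thesis
            using \<open>k' \<in> J\<close> by blast
        qed (use k in blast)
      qed
    qed (use in_Field_underS in fast)
    fix j assume j: "j \<in> J"
    have "|J| \<le>o |K|"
      unfolding J_def by (rule card_of_mono1) blast
    then show "|J| \<le>o |underS r j|"
      using ordLeq_transitive[OF _ ordLeq_transitive[OF card_of_Plus2 up[OF j]]] by blast
    show "|M| \<le>o |underS r j|"
      by (rule ordLeq_transitive[OF card_of_Plus1 up[OF j]])
  qed
qed

text \<open>The pieces \<open>V j\<close> grow for \<open>\<mu>\<^sup>+\<close> rounds, starting from initial segments of \<open>W\<close>. In each round
  the vertices with at least \<open>\<mu>\<close> neighbours in the union \<open>Z\<close> of the pieces below \<open>i\<close> are
  distributed among those same pieces, according to an injection \<open>g\<close> into the union of the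
  corresponding initial segments. As \<open>\<mu>\<^sup>+\<close> is regular, \<open>\<mu>\<close> neighbours in the final union already
  occur in some round, so the final unions are closed.\<close>

lemma col_bound_singular:
  fixes G :: "'a ugraph" and \<mu> :: "'m rel"
  assumes \<mu>: "Card_order \<mu>" "infinite (Field \<mu>)"
    and card_rich: "\<And>X. X \<subseteq> verts G \<Longrightarrow> \<mu> \<le>o |X| \<Longrightarrow> |rich \<mu> G X| \<le>o |X|"
    and W: "W \<subseteq> verts G" "\<mu> <o |W|" "\<not> regularCard |W|"
    and IH: "\<And>U. U \<subseteq> W \<Longrightarrow> |U| <o |W| \<Longrightarrow> col_bound (induced G U) \<mu>"
  shows "col_bound (induced G W) \<mu>"
proof -
  define r where "r = |W|"
  have r: "Card_order r" "Field r = W" "infinite (Field r)" and wo: "Well_order r"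
    using infinite_Field_ordLeq[OF \<mu>(2) ordLess_imp_ordLeq[OF W(2)]]
      card_of_Card_order[of W] card_of_Well_order[of W]
    unfolding r_def by (simp_all add: Field_card_of)
  define R where "R = cardSuc \<mu>"
  have R: "Card_order R" "\<mu> <o R" and infR: "infinite (Field R)" and woR: "Well_order R"
    using \<mu> cardSuc_Card_order cardSuc_greater cardSuc_finite cardSuc_Well_order
    unfolding R_def by blast+
  have wR: "wo_rel R"
    using woR by (simp add: wo_rel_def)
  have "R \<le>o |W|"
    unfolding R_def by (rule cardSuc_least[OF \<mu>(1) card_of_Card_order W(2)])
  \<comment> \<open>An infinite successor cardinal is regular, so the singular |W| lies strictly
    above it.\<close>
  moreover have "\<not> R =o |W|"
    using regularCard_ordIso[of R "|W|"] infinite_cardSuc_regularCard[OF \<mu>(2,1)] W(3) R(1) infR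
    unfolding R_def cinfinite_def by blast
  ultimately have "R <o |W|"
    by (simp add: ordLeq_iff_ordLess_or_ordIso)
  then have "|Field R| <o r"
    unfolding r_def by (rule ordIso_ordLess_trans[OF card_of_Field_ordIso[OF R(1)]])
  then obtain J where J: "J \<subseteq> W" "W = (\<Union>j\<in>J. underS r j)"
    "\<And>j. j \<in> J \<Longrightarrow> |J| \<le>o |underS r j|" "\<And>j. j \<in> J \<Longrightarrow> |Field R| \<le>o |underS r j|"
    using singular_cofinal_set[OF r(1,3)] W(3) unfolding r_def[symmetric] r(2) by metis
  have inf: "infinite (underS r j)" if "j \<in> J" for j
    using card_of_ordLeq_infinite[OF J(4)[OF that] infR] .
  have \<mu>le: "\<mu> \<le>o |underS r j|" if "j \<in> J" for j
    using ordLeq_transitive[OF ordLeq_ordIso_trans[OF ordLess_imp_ordLeq[OF R(2)]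
          ordIso_symmetric[OF card_of_Field_ordIso[OF R(1)]]] J(4)[OF that]] .
  define Cl where "Cl X = (X \<union> rich \<mu> G X) \<inter> W" for X
  define Z where "Z P i = (\<Union>j\<in>J \<inter> underS r i. P j)" for P :: "'a \<Rightarrow> 'a set" and i
  define good where "good f X i \<longleftrightarrow> inj_on f (Cl X) \<and> f ` Cl X \<subseteq> Z (underS r) i" for f X i
  \<comment> \<open>The choice is total, so the recursion can be set up before any size is known;
    \<open>bound\<close> later ensures that a suitable injection exists in every round.\<close>
  define g where "g X i = (SOME f. good f X i)" for X i
  \<comment> \<open>For each \<open>i\<close>, piece \<open>j\<close> receives only vertices with
    image in its own segment, so by injectivity no more than that segment has points; and there are
    no more indices \<open>i\<close> than such points.\<close>
  define step where "step P j = (\<Union>i\<in>J. {v \<in> Cl (Z P i). g (Z P i) i v \<in> underS r j})" for P j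
  \<comment> \<open>Every round collects the results of all earlier ones, so the pieces increase and
    limit rounds need no clause of their own.\<close>
  define \<Phi> where "\<Phi> f n j = underS r j \<union> (\<Union>m\<in>underS R n. step (f m) j)" for f n j
  define Y where "Y = wo_rel.worec R \<Phi>"
  have "wo_rel.adm_wo R \<Phi>"
    unfolding wo_rel.adm_wo_def[OF wR] \<Phi>_def by auto
  then have "Y = \<Phi> Y"
    unfolding Y_def by (rule wo_rel.worec_fixpoint[OF wR])
  then have Y: "Y n j = underS r j \<union> (\<Union>m\<in>underS R n. step (Y m) j)" for n j
    using \<Phi>_def by metis
  have g: "good (g (Z P i) i) (Z P i) i"
    if i: "i \<in> J" and P: "\<And>j. j \<in> J \<Longrightarrow> underS r j \<subseteq> P j \<and> P j \<subseteq> W \<and> |P j| \<le>o |underS r j|" for P i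
  proof -
    have "|Cl (Z P i)| \<le>o |Z (underS r) i|"
    proof (cases "J \<inter> underS r i = {}")
      case True
      \<comment> \<open>With no piece below \<open>i\<close> there is nothing to distribute: no
        vertex has \<mu> neighbours in the empty set.\<close>
      have "\<not> \<mu> \<le>o |{}::'a set|"
        using infinite_Field_ordLeq[OF \<mu>(2), of "|{}::'a set|"] by (auto simp: Field_card_of)
      then have "Cl (Z P i) = {}"
        using True unfolding Cl_def Z_def rich_def by simp
      then show ?thesis
        by (simp add: card_of_empty)
    next
      case False
      then obtain k where k: "k \<in> J" "k \<in> underS r i"
        by blast
      have sub: "underS r j \<subseteq> Z (underS r) i" if "j \<in> J" "j \<in> underS r i" for j
        using that unfolding Z_def by blast
      have infE: "infinite (Z (underS r) i)"
        using inf[OF k(1)] sub[OF k] finite_subset by blast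
      have "|Z P i| \<le>o |Z (underS r) i|"
        unfolding Z_def[of P]
      proof (rule card_of_UNION_ordLeq_infinite[OF infE], goal_cases)
        case 1
        show ?case
          by (rule ordLeq_transitive[OF card_of_mono1[OF Int_lower1]
                ordLeq_transitive[OF J(3)[OF k(1)] card_of_mono1[OF sub[OF k]]]])
      next
        case 2
        then show ?case
          using P ordLeq_transitive[OF _ card_of_mono1[OF sub]] by blast
      qed
      moreover have "Z P i \<subseteq> verts G"
        using P W(1) unfolding Z_def by blast
      moreover have "underS r k \<subseteq> Z P i"
        using P[OF k(1)] k unfolding Z_def by blast
      then have "\<mu> \<le>o |Z P i|"
        by (rule ordLeq_transitive[OF \<mu>le[OF k(1)] card_of_mono1])
      ultimately have "|rich \<mu> G (Z P i)| \<le>o |Z (underS r) i|" "|Z P i| \<le>o |Z (underS r) i|"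
        using card_rich[of "Z P i"] ordLeq_transitive by blast+
      then have "|Z P i \<union> rich \<mu> G (Z P i)| \<le>o |Z (underS r) i|"
        using card_of_Un_ordLeq_infinite[OF infE] by blast
      moreover have "|Cl (Z P i)| \<le>o |Z P i \<union> rich \<mu> G (Z P i)|"
        unfolding Cl_def by (rule card_of_mono1) blast
      ultimately show ?thesis
        using ordLeq_transitive by blast
    qed
    then have "\<exists>f. good f (Z P i) i"
      unfolding good_def card_of_ordLeq[symmetric] .
    then show ?thesis
      unfolding g_def by (rule someI_ex)
  qed
  have step: "|step P j| \<le>o |underS r j|"
    if j: "j \<in> J" and P: "\<And>j. j \<in> J \<Longrightarrow> underS r j \<subseteq> P j \<and> P j \<subseteq> W \<and> |P j| \<le>o |underS r j|" for P j
    unfolding step_def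
  proof (rule card_of_UNION_ordLeq_infinite[OF inf[OF j] J(3)[OF j]], rule)
    fix i assume "i \<in> J"
    then have "good (g (Z P i) i) (Z P i) i"
      using g P by blast
    then have "inj_on (g (Z P i) i) (Cl (Z P i))"
      unfolding good_def by blast
    then show "|{v \<in> Cl (Z P i). g (Z P i) i v \<in> underS r j}| \<le>o |underS r j|"
      by (intro card_of_ordLeqI) (auto intro: inj_on_subset)
  qed
  have dom: "underS r j \<subseteq> W" for j
    using in_Field_underS r(2) by fast
  have bound: "\<forall>j\<in>J. underS r j \<subseteq> Y n j \<and> Y n j \<subseteq> W \<and> |Y n j| \<le>o |underS r j|" for n
  proof (induction n rule: wo_rel.well_order_induct[OF wR])
    case (1 n)
    then have P: "\<forall>j\<in>J. underS r j \<subseteq> Y m j \<and> Y m j \<subseteq> W \<and> |Y m j| \<le>o |underS r j|"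
      if "m \<in> underS R n" for m
      using that unfolding underS_def by blast
    show ?case
    proof
      fix j assume j: "j \<in> J"
      have st: "|step (Y m) j| \<le>o |underS r j|" if "m \<in> underS R n" for m
        using step[OF j] P[OF that] by blast
      have n: "|underS R n| \<le>o |Field R|"
        by (rule card_of_mono1) (use in_Field_underS in fast)
      have "|\<Union>m\<in>underS R n. step (Y m) j| \<le>o |underS r j|"
        by (rule card_of_UNION_ordLeq_infinite[OF inf[OF j] ordLeq_transitive[OF n J(4)[OF j]]])
          (simp add: st)
      then have "|Y n j| \<le>o |underS r j|"
        unfolding Y[of n]
        by (rule card_of_Un_ordLeq_infinite[OF inf[OF j] ordLeq_reflexive[OF card_of_Well_order]])
      moreover have "step (Y m) j \<subseteq> W" for m
        unfolding step_def Cl_def by blast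
      then have "Y n j \<subseteq> W" "underS r j \<subseteq> Y n j"
        unfolding Y[of n] using dom by blast+
      ultimately show "underS r j \<subseteq> Y n j \<and> Y n j \<subseteq> W \<and> |Y n j| \<le>o |underS r j|"
        by blast
    qed
  qed
  define V where "V j = (\<Union>n\<in>Field R. Y n j)" for j
  obtain n0 where "n0 \<in> Field R"
    using infR by fastforce
  then have subV: "underS r j \<subseteq> V j" for j
    unfolding V_def using Y[of n0 j] by blast
  have VW: "V j \<subseteq> W" if "j \<in> J" for j
    using bound that unfolding V_def by blast
  show ?thesis
  proof (rule col_bound_glue[OF \<mu> wo])
    show "J \<subseteq> Field r"
      using J(1) r(2) by simp
    show "W = (\<Union>j\<in>J. V j)"
      using subV J(2) VW by blast
    fix i assume i: "i \<in> J"
    have "|V i| \<le>o |underS r i|"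
      unfolding V_def
      by (rule card_of_UNION_ordLeq_infinite[OF inf[OF i] J(4)[OF i]]) (use bound i in blast)
    moreover have "|underS r i| <o |W|"
      using card_of_underS[OF r(1), of i] i J(1) r(2) unfolding r_def by blast
    ultimately show "col_bound (induced G (V i)) \<mu>"
      using IH[OF VW[OF i]] ordLeq_ordLess_trans by blast
    fix v assume v: "v \<in> W" "v \<notin> (\<Union>j\<in>J \<inter> underS r i. V j)"
    have V: "(\<Union>j\<in>J \<inter> underS r i. V j) = (\<Union>n\<in>Field R. Z (Y n) i)"
      unfolding V_def Z_def by blast
    show "|nbrs G v \<inter> (\<Union>j\<in>J \<inter> underS r i. V j)| <o \<mu>"
    proof (rule ccontr)
      have "Well_order \<mu>"
        using \<mu>(1) by (simp add: card_order_on_def)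
      moreover assume "\<not> ?thesis"
      ultimately have "\<mu> \<le>o |nbrs G v \<inter> (\<Union>n\<in>Field R. Z (Y n) i)|"
        unfolding V using not_ordLess_iff_ordLeq[OF _ card_of_Well_order] by blast
      \<comment> \<open>Only \<mu> of the neighbours are kept: a set of that size inside an
        increasing union of length \<open>\<mu>\<^sup>+\<close> lies in one member.\<close>
      then obtain B where B: "B \<subseteq> nbrs G v \<inter> (\<Union>n\<in>Field R. Z (Y n) i)" "|B| =o \<mu>"
        by (rule card_ordLeq_obtain_subset[OF \<mu>(1)])
      have "Y m j \<subseteq> Y n j" if "(m, n) \<in> R" for m n j
        using underS_subset[OF woR that] unfolding Y[of m j] Y[of n j] by blast
      then have "relChain R (\<lambda>n. Z (Y n) i)"
        unfolding relChain_def Z_def by blast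
      then obtain n where n: "n \<in> Field R" "B \<subseteq> Z (Y n) i"
        using cardSuc_UNION[OF \<mu>, of "\<lambda>n. Z (Y n) i" B] B ordIso_imp_ordLeq unfolding R_def by blast
      have "B \<subseteq> nbrs G v \<inter> Z (Y n) i"
        using B(1) n(2) by blast
      then have "\<mu> \<le>o |nbrs G v \<inter> Z (Y n) i|"
        by (rule ordIso_ordLeq_trans[OF ordIso_symmetric[OF B(2)] card_of_mono1])
      then have "v \<in> Cl (Z (Y n) i)"
        using v(1) W(1) unfolding Cl_def rich_def by blast
      moreover have "good (g (Z (Y n) i) i) (Z (Y n) i) i"
        using g[OF i] bound by blast
      ultimately have "g (Z (Y n) i) i v \<in> Z (underS r) i"
        unfolding good_def by blast
      then obtain j where j: "j \<in> J" "j \<in> underS r i" "g (Z (Y n) i) i v \<in> underS r j"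
        unfolding Z_def[of "underS r"] by blast
      then have "v \<in> step (Y n) j"
        using i \<open>v \<in> Cl (Z (Y n) i)\<close> unfolding step_def by blast
      moreover obtain n' where n': "n' \<in> Field R" "n \<in> underS R n'"
        using infinite_Card_order_limit[OF R(1) infR n(1)] unfolding underS_def by blast
      ultimately have "v \<in> V j"
        unfolding V_def using Y[of n' j] by blast
      then show False
        using v(2) j by blast
    qed
  qed
qed

section \<open>Regular cardinals\<close>

text \<open>A stationary set of \<open>\<delta>\<close> with a witness \<open>q \<delta>\<close> outside the initial segment below \<open>\<delta>\<close> is turned
  into an obstruction of type II by rearranging the well-order so that \<open>q \<delta>\<close> comes directly after
  the initial segment below \<open>\<delta>\<close>. The rearranged order is the pullback of \<open>r\<close> along the injection
  \<open>\<pi>\<close> that sends \<open>q \<delta>\<close> to \<open>\<delta>\<close> and every other element to its successor; the two kinds of values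
  do not collide because the \<open>\<delta>\<close> are limits.\<close>

lemma stationary_imp_obstruction_II:
  fixes G :: "'a ugraph" and \<mu> :: "'m rel" and r :: "'a rel"
  assumes \<mu>: "Card_order \<mu>" "infinite (Field \<mu>)"
    and G: "simple_graph G" "verts G = Field r"
    and r: "Card_order r" "\<mu> <o r" "regularCard r"
    and h: "\<And>a. a \<in> Field r \<Longrightarrow> a \<in> underS r (h a)"
    and capture: "\<And>a v. a \<in> Field r \<Longrightarrow> v \<in> Field r \<Longrightarrow> \<mu> \<le>o |nbrs G v \<inter> underS r a| \<Longrightarrow>
      v \<in> underS r (h a)"
    and stat: "stationary r {\<delta> \<in> closure_points r h.
      \<exists>v\<in>Field r. v \<notin> underS r \<delta> \<and> \<mu> \<le>o |nbrs G v \<inter> underS r \<delta>|}"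
  shows "obstruction_II \<mu> G"
proof -
  define B where "B = {\<delta> \<in> closure_points r h.
    \<exists>v\<in>Field r. v \<notin> underS r \<delta> \<and> \<mu> \<le>o |nbrs G v \<inter> underS r \<delta>|}"
  have wo: "Well_order r" and wo\<mu>: "Well_order \<mu>"
    using r(1) \<mu>(1) by (simp_all add: card_order_on_def)
  have inf: "infinite (Field r)"
    using infinite_Field_ordLeq[OF \<mu>(2) ordLess_imp_ordLeq[OF r(2)]] .
  have BF: "\<delta> \<in> Field r" and Bh: "\<And>a. a \<in> underS r \<delta> \<Longrightarrow> h a \<in> underS r \<delta>" if "\<delta> \<in> B" for \<delta>
    using that unfolding B_def closure_points_def by blast+
  have "\<exists>v. v \<in> Field r \<and> v \<notin> underS r \<delta> \<and> \<mu> \<le>o |nbrs G v \<inter> underS r \<delta>|" if "\<delta> \<in> B" for \<delta>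
    using that unfolding B_def by blast
  then obtain q where q: "\<And>\<delta>. \<delta> \<in> B \<Longrightarrow> q \<delta> \<in> Field r" "\<And>\<delta>. \<delta> \<in> B \<Longrightarrow> q \<delta> \<notin> underS r \<delta>"
    "\<And>\<delta>. \<delta> \<in> B \<Longrightarrow> \<mu> \<le>o |nbrs G (q \<delta>) \<inter> underS r \<delta>|"
    by metis
  \<comment> \<open>By \<open>capture\<close> at \<delta>, the witness lies below
    \<open>h \<delta>\<close>, hence below every later member of \<open>B\<close>: witnesses
    interleave with \<open>B\<close>.\<close>
  have q_less: "q \<delta> \<in> underS r \<delta>'" if "\<delta> \<in> B" "\<delta>' \<in> B" "\<delta> \<in> underS r \<delta>'" for \<delta> \<delta>'
    using capture[OF BF q(1) q(3)] that Bh underS_trans[OF wo] by blast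
  have inj_q: "inj_on q B"
  proof (rule inj_onI)
    fix \<delta> \<delta>' assume "\<delta> \<in> B" "\<delta>' \<in> B" "q \<delta> = q \<delta>'"
    then show "\<delta> = \<delta>'"
      using underS_linear[OF wo BF BF, of \<delta> \<delta>'] q_less q(2) by metis
  qed
  have "\<exists>x. w \<in> underS r x \<and> (\<forall>y\<in>underS r x. y = w \<or> y \<in> underS r w)" if w: "w \<in> Field r" for w
  proof -
    have "{x \<in> Field r. w \<in> underS r x} \<noteq> {}"
      using infinite_Card_order_limit[OF r(1) inf w] unfolding underS_def by blast
    then obtain x where x: "x \<in> {x \<in> Field r. w \<in> underS r x}"
      "\<And>y. y \<in> {x \<in> Field r. w \<in> underS r x} \<Longrightarrow> y \<notin> underS r x"
      using Well_order_least[OF wo, of "{x \<in> Field r. w \<in> underS r x}"] by blast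
    have "y = w \<or> y \<in> underS r w" if y: "y \<in> underS r x" for y
    proof -
      have "y \<in> Field r" "w \<notin> underS r y"
        using x(2)[of y] y in_Field_underS[OF y] by auto
      then show ?thesis
        using underS_linear[OF wo _ w] by blast
    qed
    then show ?thesis
      using x(1) by blast
  qed
  then obtain sc where sc: "\<And>w. w \<in> Field r \<Longrightarrow> w \<in> underS r (sc w)"
    "\<And>w y. w \<in> Field r \<Longrightarrow> y \<in> underS r (sc w) \<Longrightarrow> y = w \<or> y \<in> underS r w"
    by metis
  have sc_B: "sc w \<notin> B" if w: "w \<in> Field r" for w
  proof
    assume "sc w \<in> B"
    then have "h w \<in> underS r (sc w)"
      using Bh sc(1)[OF w] by blast
    then have "h w = w \<or> h w \<in> underS r w"
      using sc(2)[OF w] by blast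
    then show False
      using h[OF w] underS_asym[OF wo] by metis
  qed
  define \<pi> where "\<pi> w = (if w \<in> q ` B then inv_into B q w else sc w)" for w
  have \<pi>q: "\<pi> (q \<delta>) = \<delta>" if "\<delta> \<in> B" for \<delta>
    using that inj_q unfolding \<pi>_def by simp
  have \<pi>sc: "\<pi> w = sc w" if "w \<notin> q ` B" for w
    using that unfolding \<pi>_def by simp
  have \<pi>F: "\<pi> w \<in> Field r" if "w \<in> Field r" for w
    using that \<pi>q BF \<pi>sc sc(1) in_Field_underS by (cases "w \<in> q ` B") fastforce+
  have inj: "inj_on \<pi> (Field r)"
  proof (rule inj_onI)
    fix v w assume vw: "v \<in> Field r" "w \<in> Field r" "\<pi> v = \<pi> w"
    have iff: "u \<in> q ` B \<longleftrightarrow> \<pi> u \<in> B" if "u \<in> Field r" for u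
      using \<pi>q \<pi>sc sc_B[OF that] by (cases "u \<in> q ` B") auto
    show "v = w"
    proof (cases "v \<in> q ` B")
      case True
      then have "w \<in> q ` B"
        using iff vw by metis
      then show ?thesis
        using True \<pi>q vw(3) by auto
    next
      case False
      then have "w \<notin> q ` B"
        using iff vw by metis
      then have "sc v = sc w"
        using False \<pi>sc vw(3) by simp
      then have "v = w \<or> v \<in> underS r w" "w = v \<or> w \<in> underS r v"
        using sc vw(1,2) by metis+
      then show ?thesis
        using underS_asym[OF wo] by blast
    qed
  qed
  define s where "s = {(v, w). v \<in> Field r \<and> w \<in> Field r \<and> (\<pi> v, \<pi> w) \<in> r}"
  have s: "well_order_on (Field r) s"
  proof (rule well_order_onI)
    show "s \<subseteq> Field r \<times> Field r"
      unfolding s_def by blast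
    show "antisym s"
    proof (rule antisymI)
      fix v w assume "(v, w) \<in> s" "(w, v) \<in> s"
      then have "v \<in> Field r" "w \<in> Field r" "\<pi> v = \<pi> w"
        using wo_rel.ANTISYM[of r] wo unfolding wo_rel_def antisym_def s_def by blast+
      then show "v = w"
        using inj unfolding inj_on_def by blast
    qed
    show "trans s"
      using wo_rel.TRANS[of r] wo unfolding wo_rel_def trans_def s_def by blast
    fix S assume S: "S \<subseteq> Field r" "S \<noteq> {}"
    then have "\<pi> ` S \<subseteq> Field r" "\<pi> ` S \<noteq> {}"
      using \<pi>F by auto
    then obtain x where x: "x \<in> \<pi> ` S" "\<And>y. y \<in> \<pi> ` S \<Longrightarrow> y \<notin> underS r x"
      using Well_order_least[OF wo, of "\<pi> ` S"] by blast
    then obtain m where m: "m \<in> S" "x = \<pi> m"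
      by blast
    have "(\<pi> m, \<pi> w) \<in> r" if "w \<in> S" for w
      using le_iff_not_underS[OF wo \<pi>F \<pi>F, of m w] x(2)[of "\<pi> w"] m S(1) that by blast
    then show "\<exists>m\<in>S. \<forall>x\<in>S. (m, x) \<in> s"
      using m(1) S(1) unfolding s_def by blast
  qed
  have sF: "Field s = Field r" and wos: "Well_order s"
    using well_order_on_Well_order[OF s] by auto
  have underS_s: "v \<in> underS s w \<longleftrightarrow> \<pi> v \<in> underS r (\<pi> w)" if "v \<in> Field r" "w \<in> Field r" for v w
    using that inj unfolding s_def underS_def inj_on_def by auto
  \<comment> \<open>\<pi> moves points but preserves membership in the segment below \<delta>: for
    witnesses by \<open>q_less\<close>, for other points because \<delta> is closed under the
    strictly increasing \<open>h\<close>.\<close>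
  have segment: "underS s (q \<delta>) = underS r \<delta>" if \<delta>: "\<delta> \<in> B" for \<delta>
  proof -
    have "\<pi> v \<in> underS r \<delta> \<longleftrightarrow> v \<in> underS r \<delta>" if v: "v \<in> Field r" for v
    proof (cases "v \<in> q ` B")
      case True
      then obtain \<delta>' where \<delta>': "\<delta>' \<in> B" "v = q \<delta>'"
        by blast
      then show ?thesis
        using \<pi>q q_less[of \<delta>' \<delta>] \<delta> q(2) underS_linear[OF wo BF[OF \<delta>] BF, of \<delta>'] underS_trans[OF wo]
        by metis
    next
      case False
      have "sc v \<in> underS r \<delta>" if "v \<in> underS r \<delta>"
      proof -
        have "h v \<notin> underS r (sc v)"
          using sc(2)[OF v, of "h v"] h[OF v] underS_asym[OF wo] by metis
        then have "sc v = h v \<or> sc v \<in> underS r (h v)"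
          using underS_linear[OF wo, of "sc v" "h v"] sc(1)[OF v] h[OF v] in_Field_underS by metis
        then show ?thesis
          using Bh[OF \<delta> that] underS_trans[OF wo] by metis
      qed
      then show ?thesis
        using \<pi>sc[OF False] sc(1)[OF v] underS_trans[OF wo] by metis
    qed
    then have *: "v \<in> underS s (q \<delta>) \<longleftrightarrow> v \<in> underS r \<delta>" if "v \<in> Field r" for v
      using underS_s[OF that q(1)[OF \<delta>]] \<pi>q[OF \<delta>] that by simp
    show ?thesis
      using * in_Field_underS[of _ s] in_Field_underS[of _ r] sF by blast
  qed
  \<comment> \<open>Needed because neighbours are counted in segments of \<open>r\<close>. The bound
    is \<open>h (\<pi> a)\<close>: a witness u up to \<open>a\<close> has \<mu> neighbours below
    \<open>\<pi> a\<close> and is captured; any other u satisfies u < \<open>sc u\<close> \<le>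
    \<open>\<pi> a\<close>.\<close>
  have initial: "\<exists>\<alpha>\<in>underS r \<delta>. \<forall>u\<in>Field r. u \<in> underS s a \<or> u = a \<longrightarrow> u \<in> underS r \<alpha>"
    if \<delta>: "\<delta> \<in> B" and a: "a \<in> underS r \<delta>" for \<delta> a
  proof (intro bexI ballI impI)
    have aF: "a \<in> Field r"
      using in_Field_underS[OF a] by blast
    have "a \<in> underS s (q \<delta>)"
      using a segment[OF \<delta>] by simp
    then have \<pi>a: "\<pi> a \<in> underS r \<delta>"
      using underS_s[OF aF q(1)[OF \<delta>]] \<pi>q[OF \<delta>] by simp
    then show "h (\<pi> a) \<in> underS r \<delta>"
      using Bh[OF \<delta>] by blast
    fix u assume u: "u \<in> Field r" "u \<in> underS s a \<or> u = a"
    then have "\<pi> u \<in> underS r (\<pi> a) \<or> \<pi> u = \<pi> a"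
      using underS_s[OF u(1) aF] by blast
    then have le: "underS r (\<pi> u) \<subseteq> underS r (\<pi> a)"
      using underS_trans[OF wo] by auto
    show "u \<in> underS r (h (\<pi> a))"
    proof (cases "u \<in> q ` B")
      case True
      then obtain \<delta>' where \<delta>': "\<delta>' \<in> B" "u = q \<delta>'"
        by blast
      have "underS r \<delta>' \<subseteq> underS r (\<pi> a)"
        using le \<pi>q \<delta>' by simp
      then have "\<mu> \<le>o |nbrs G u \<inter> underS r (\<pi> a)|"
        using ordLeq_transitive[OF q(3)[OF \<delta>'(1)] card_of_mono1] \<delta>'(2) by blast
      then show ?thesis
        by (rule capture[OF \<pi>F[OF aF] u(1)])
    next
      case False
      then have "u \<in> underS r (\<pi> a)"
        using le \<pi>sc sc(1)[OF u(1)] by auto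
      then show ?thesis
        using underS_trans[OF wo _ h[OF \<pi>F[OF aF]]] by blast
    qed
  qed
  \<comment> \<open>Otherwise \<open>capture\<close> would put \<open>q \<delta>\<close> below
    \<open>h \<alpha>\<close>, hence below \<delta>.\<close>
  have small: "|nbrs G (q \<delta>) \<inter> underS r \<alpha>| <o \<mu>" if \<delta>: "\<delta> \<in> B" and \<alpha>: "\<alpha> \<in> underS r \<delta>" for \<delta> \<alpha>
  proof (rule ccontr)
    assume "\<not> ?thesis"
    then have "\<mu> \<le>o |nbrs G (q \<delta>) \<inter> underS r \<alpha>|"
      using not_ordLess_iff_ordLeq[OF wo\<mu> card_of_Well_order] by blast
    then have "q \<delta> \<in> underS r (h \<alpha>)"
      using capture[OF _ q(1)[OF \<delta>]] in_Field_underS[OF \<alpha>] by blast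
    then show False
      using q(2)[OF \<delta>] Bh[OF \<delta> \<alpha>] underS_trans[OF wo] by blast
  qed
  have in_T: "q \<delta> \<in> T_set \<mu> s G" if \<delta>: "\<delta> \<in> B" for \<delta>
  proof (rule T_setI[OF wos], unfold segment[OF \<delta>])
    let ?N = "nbrs G (q \<delta>) \<inter> underS r \<delta>"
    show "q \<delta> \<in> Field s"
      using q(1)[OF \<delta>] sF by simp
    have NF: "?N \<subseteq> Field r"
      using in_Field_underS by fast
    then have F: "Field (Restr s ?N) = ?N"
      using Refl_Field_Restr2[of s ?N] wos sF by (auto simp: order_on_defs)
    show "Restr s ?N =o \<mu>"
    proof (rule ordIso_if_small_segments[OF Well_order_Restr[OF wos] \<mu>(1)], unfold F)
      show "\<mu> \<le>o |?N|"
        by (rule q(3)[OF \<delta>])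
      fix a assume a: "a \<in> ?N"
      then obtain \<alpha> where \<alpha>: "\<alpha> \<in> underS r \<delta>" "\<forall>u\<in>Field r. u \<in> underS s a \<or> u = a \<longrightarrow> u \<in> underS r \<alpha>"
        using initial[OF \<delta>, of a] by blast
      have "underS (Restr s ?N) a \<subseteq> nbrs G (q \<delta>) \<inter> underS r \<alpha>"
        using \<alpha>(2) NF unfolding underS_def[of "Restr s ?N"] underS_def[of s] by blast
      then show "|underS (Restr s ?N) a| <o \<mu>"
        by (rule ordLeq_ordLess_trans[OF card_of_mono1 small[OF \<delta> \<alpha>(1)]])
    qed
    fix x assume x: "x \<in> underS r \<delta>"
    then have xF: "x \<in> Field r"
      using in_Field_underS by fast
    obtain \<alpha> where \<alpha>: "\<alpha> \<in> underS r \<delta>" "\<forall>u\<in>Field r. u \<in> underS s x \<or> u = x \<longrightarrow> u \<in> underS r \<alpha>"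
      using initial[OF \<delta> x] by blast
    show "\<exists>a\<in>?N. x \<in> underS s a"
    proof (rule ccontr)
      assume neg: "\<not> ?thesis"
      have "?N \<subseteq> nbrs G (q \<delta>) \<inter> underS r \<alpha>"
      proof
        fix a assume a: "a \<in> ?N"
        then have "a \<in> Field r" "x \<notin> underS s a"
          using NF neg by blast+
        then have "a \<in> underS s x \<or> a = x"
          using underS_linear[OF wos, of a x] sF xF by simp
        then show "a \<in> nbrs G (q \<delta>) \<inter> underS r \<alpha>"
          using \<alpha>(2) a \<open>a \<in> Field r\<close> by blast
      qed
      then have "|?N| <o \<mu>"
        by (rule ordLeq_ordLess_trans[OF card_of_mono1 small[OF \<delta> \<alpha>(1)]])
      then show False
        using q(3)[OF \<delta>] not_ordLess_ordLeq by blast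
    qed
  qed
  have s_iso: "s =o r"
  proof (rule ordIso_if_small_segments[OF wos r(1)], unfold sF)
    show "r \<le>o |Field r|"
      using card_of_Field_ordIso[OF r(1)] ordIso_iff_ordLeq by blast
    fix w assume w: "w \<in> Field r"
    have "v \<in> Field r" if "v \<in> underS s w" for v
      using in_Field_underS[OF that] sF by simp
    then have "|underS s w| \<le>o |underS r (\<pi> w)|"
      using inj underS_s[OF _ w] by (intro card_of_ordLeqI[of \<pi>]) (auto intro: inj_on_subset)
    then show "|underS s w| <o r"
      by (rule ordLeq_ordLess_trans[OF _ card_of_underS[OF r(1) \<pi>F[OF w]]])
  qed
  have "stationary s (T_set \<mu> s G)"
    unfolding stationary_def
  proof (intro conjI allI impI)
    show "T_set \<mu> s G \<subseteq> Field s"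
      unfolding T_set_def by blast
    fix D assume D: "club s D"
    \<comment> \<open>A club of \<open>s\<close> need not be one of \<open>r\<close>; it is probed
      through \<open>d\<close>. At \<delta> in \<open>B\<close> closed under \<open>d\<close>, it is
      unbounded in the common segment, so it contains \<open>q \<delta>\<close>.\<close>
    obtain d where d: "\<And>a. a \<in> Field r \<Longrightarrow> d a \<in> D" "\<And>a. a \<in> Field r \<Longrightarrow> a \<in> underS s (d a)"
      using club_unbounded[OF D] sF by metis
    have "club r (closure_points r d)"
    proof (rule club_closure_points[OF r(1) natLeq_ordLess[OF \<mu> r(2)] r(3)])
      show "d a \<in> Field r" if "a \<in> Field r" for a
        using d(1)[OF that] D sF unfolding club_def by blast
    qed
    then obtain \<delta> where \<delta>: "\<delta> \<in> B" "\<delta> \<in> closure_points r d"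
      using stat unfolding stationary_def B_def by blast
    have dS: "d x \<in> D \<inter> underS s (q \<delta>) \<and> x \<in> underS s (d x)" if "x \<in> underS r \<delta>" for x
      using that d[of x] \<delta>(2) in_Field_underS[OF that]
      unfolding segment[OF \<delta>(1)] closure_points_def by blast
    have "underS r \<delta> \<noteq> {}"
    proof
      assume "underS r \<delta> = {}"
      then have "\<mu> \<le>o |{}::'a set|"
        using q(3)[OF \<delta>(1)] by simp
      then show False
        using infinite_Field_ordLeq[OF \<mu>(2), of "|{}::'a set|"] by (auto simp: Field_card_of)
    qed
    then have "D \<inter> underS s (q \<delta>) \<noteq> {}"
      using dS by blast
    moreover have "wo_rel.supr s (D \<inter> underS s (q \<delta>)) = q \<delta>"
    proof (rule supr_eqI[OF wos])
      show "q \<delta> \<in> Field s"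
        using q(1)[OF \<delta>(1)] sF by simp
      show "\<exists>a\<in>D \<inter> underS s (q \<delta>). x \<in> underS s a" if "x \<in> underS s (q \<delta>)" for x
        using dS[of x] that segment[OF \<delta>(1)] by blast
    qed blast
    ultimately have "q \<delta> \<in> D"
      using D q(1)[OF \<delta>(1)] sF unfolding club_def by blast
    then show "T_set \<mu> s G \<inter> D \<noteq> {}"
      using in_T[OF \<delta>(1)] by blast
  qed
  moreover have "regularCard s"
    using regularCard_ordIso[OF ordIso_symmetric[OF s_iso]] r(1,3) inf unfolding cinfinite_def by blast
  moreover have "Card_order s"
    by (rule Card_order_ordIso[OF r(1) s_iso])
  moreover have "\<mu> <o s"
    by (rule ordLess_ordIso_trans[OF r(2) ordIso_symmetric[OF s_iso]])
  ultimately have "standard_obstruction_II \<mu> s G"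
    using G sF unfolding standard_obstruction_II_def by simp
  moreover have "graph_iso G G"
    unfolding graph_iso_def by (rule exI[of _ id]) simp
  ultimately show ?thesis
    using G(1) unfolding obstruction_II_def by blast
qed

text \<open>Cut points \<delta> with a bad vertex form a nonstationary set, so W can be cut along a
  club whose points, apart from possibly the least element, all avoid it.\<close>

lemma col_bound_regular:
  fixes G :: "'a ugraph" and \<mu> :: "'m rel"
  assumes \<mu>: "Card_order \<mu>" "infinite (Field \<mu>)" and G: "simple_graph G"
    and card_rich: "\<And>X. X \<subseteq> verts G \<Longrightarrow> \<mu> \<le>o |X| \<Longrightarrow> |rich \<mu> G X| \<le>o |X|"
    and W: "W \<subseteq> verts G" "\<mu> <o |W|" "regularCard |W|"
    and noII: "\<not> obstruction_II \<mu> (induced G W)"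
    and IH: "\<And>U. U \<subseteq> W \<Longrightarrow> |U| <o |W| \<Longrightarrow> col_bound (induced G U) \<mu>"
  shows "col_bound (induced G W) \<mu>"
proof -
  define r where "r = |W|"
  have r: "Card_order r" "Field r = W" "infinite (Field r)" and wo: "Well_order r"
    using infinite_Field_ordLeq[OF \<mu>(2) ordLess_imp_ordLeq[OF W(2)]]
      card_of_Card_order[of W] card_of_Well_order[of W]
    unfolding r_def by (simp_all add: Field_card_of)
  have \<mu>r: "\<mu> <o r" "regularCard r"
    using W(2,3) unfolding r_def by blast+
  have wo\<mu>: "Well_order \<mu>"
    using \<mu>(1) by (simp add: card_order_on_def)
  have dom: "underS r a \<subseteq> W" for a
    using in_Field_underS r(2) by fast
  have fin: "|F| <o r" if "finite F" for F :: "'a set"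
    by (rule finite_ordLess_infinite[OF card_of_Well_order wo _ r(3)]) (simp add: that Field_card_of)
  \<comment> \<open>All vertices with \<mu> neighbours in a segment are bounded, by
    \<open>card_rich\<close> and regularity; this provides the hypothesis
    \<open>capture\<close>.\<close>
  have "\<exists>b. insert a (rich \<mu> G (underS r a) \<inter> W) \<subseteq> underS r b" if a: "a \<in> W" for a
  proof -
    have "|rich \<mu> G (underS r a)| <o r"
    proof (cases "\<mu> \<le>o |underS r a|")
      case True
      then have "|rich \<mu> G (underS r a)| \<le>o |underS r a|"
        using card_rich dom W(1) by blast
      then show ?thesis
        by (rule ordLeq_ordLess_trans[OF _ card_of_underS[OF r(1)]]) (use a r(2) in simp)
    next
      case False
      then have "rich \<mu> G (underS r a) = {}"
        unfolding rich_def using ordLeq_transitive[OF _ card_of_mono1[OF Int_lower2]] by blast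
      then show ?thesis
        using fin[of "{}"] by simp
    qed
    then have "|rich \<mu> G (underS r a) \<inter> W| <o r"
      by (rule ordLeq_ordLess_trans[OF card_of_mono1[OF Int_lower1]])
    then have "|{a} \<union> (rich \<mu> G (underS r a) \<inter> W)| <o r"
      by (intro card_of_Un_ordLess_infinite_Field[OF r(3,1) fin]) simp_all
    then obtain b where "{a} \<union> (rich \<mu> G (underS r a) \<inter> W) \<subseteq> underS r b"
      using regular_bounded[OF r(1,3) \<mu>r(2)] a r(2) by (metis Int_lower2 Un_least empty_subsetI insert_subset)
    then show ?thesis
      by auto
  qed
  then obtain h where h: "\<And>a. a \<in> W \<Longrightarrow> a \<in> underS r (h a)"
    "\<And>a. a \<in> W \<Longrightarrow> rich \<mu> G (underS r a) \<inter> W \<subseteq> underS r (h a)"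
    by (metis insert_subset)
  define B where "B = {\<delta> \<in> closure_points r h.
    \<exists>v\<in>W. v \<notin> underS r \<delta> \<and> \<mu> \<le>o |nbrs G v \<inter> underS r \<delta>|}"
  have nb: "nbrs (induced G W) v \<inter> underS r a = nbrs G v \<inter> underS r a" if "v \<in> W" for v a
    using that dom by auto
  have "\<not> stationary r B"
  proof
    assume B: "stationary r B"
    have "obstruction_II \<mu> (induced G W)"
    proof (rule stationary_imp_obstruction_II[OF \<mu> simple_graph_induced[OF G] _ r(1) \<mu>r],
        unfold r(2))
      show "a \<in> underS r (h a)" if "a \<in> W" for a
        by (rule h(1)[OF that])
      show "v \<in> underS r (h a)"
        if "a \<in> W" "v \<in> W" "\<mu> \<le>o |nbrs (induced G W) v \<inter> underS r a|" for a v
        using that h(2)[OF that(1)] W(1) unfolding nb[OF that(2)] rich_def by blast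
      have "B = {\<delta> \<in> closure_points r h.
          \<exists>v\<in>W. v \<notin> underS r \<delta> \<and> \<mu> \<le>o |nbrs (induced G W) v \<inter> underS r \<delta>|}"
        unfolding B_def using nb by (metis (no_types, lifting))
      then show "stationary r {\<delta> \<in> closure_points r h.
          \<exists>v\<in>W. v \<notin> underS r \<delta> \<and> \<mu> \<le>o |nbrs (induced G W) v \<inter> underS r \<delta>|}"
        using B by simp
    qed simp
    then show False
      using noII by blast
  qed
  moreover have "B \<subseteq> Field r"
    unfolding B_def closure_points_def by blast
  ultimately obtain D where D: "club r D" "B \<inter> D = {}"
    unfolding stationary_def by blast
  obtain d where d: "\<And>a. a \<in> W \<Longrightarrow> d a \<in> D" "\<And>a. a \<in> W \<Longrightarrow> a \<in> underS r (d a)"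
    using club_unbounded[OF D(1)] r(2) by metis
  have hd: "h a \<in> W" "d a \<in> W" if "a \<in> W" for a
    using h(1)[OF that] d(2)[OF that] in_Field_underS r(2) by metis+
  \<comment> \<open>One function dominating both \<open>h\<close> and \<open>d\<close> replaces the
    intersection of two clubs.\<close>
  have "\<exists>b\<in>W. {h a, d a} \<subseteq> underS r b" if a: "a \<in> W" for a
    using regular_bounded[OF r(1,3) \<mu>r(2) _ fin, of "{h a, d a}"] hd[OF a] r(2)
    by (metis (no_types, lifting) empty_subsetI finite.emptyI finite.insertI insert_subset)
  then obtain k where k: "\<And>a. a \<in> W \<Longrightarrow> k a \<in> W" "\<And>a. a \<in> W \<Longrightarrow> {h a, d a} \<subseteq> underS r (k a)"
    by metis
  define E where "E = closure_points r k"
  have E: "h a \<in> underS r \<delta>" "d a \<in> underS r \<delta>" if "\<delta> \<in> E" "a \<in> underS r \<delta>" for \<delta> a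
  proof -
    have "k a \<in> underS r \<delta>" "a \<in> W"
      using that dom unfolding E_def closure_points_def by blast+
    then show "h a \<in> underS r \<delta>" "d a \<in> underS r \<delta>"
      using k(2)[of a] underS_trans[OF wo] by blast+
  qed
  have EW: "E \<subseteq> W"
    unfolding E_def closure_points_def using r(2) by blast
  have "club r E"
    unfolding E_def using club_closure_points[OF r(1) natLeq_ordLess[OF \<mu> \<mu>r(1)] \<mu>r(2)] k(1) r(2)
    by blast
  then have cof: "\<exists>\<delta>\<in>E. a \<in> underS r \<delta>" if "a \<in> W" for a
    using club_unbounded that r(2) by metis
  have sparse: "|nbrs G v \<inter> underS r \<delta>| <o \<mu>"
    if \<delta>: "\<delta> \<in> E" "underS r \<delta> \<noteq> {}" and v: "v \<in> W" "v \<notin> underS r \<delta>" for \<delta> v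
  proof -
    have \<delta>F: "\<delta> \<in> Field r"
      using \<delta>(1) EW r(2) by blast
    have dS: "d x \<in> D \<inter> underS r \<delta> \<and> x \<in> underS r (d x)" if "x \<in> underS r \<delta>" for x
      using that E(2)[OF \<delta>(1)] d dom by blast
    then have "D \<inter> underS r \<delta> \<noteq> {}"
      using \<delta>(2) by blast
    moreover have "wo_rel.supr r (D \<inter> underS r \<delta>) = \<delta>"
      by (rule supr_eqI[OF wo _ \<delta>F]) (use dS in blast)+
    ultimately have "\<delta> \<in> D"
      using D(1) \<delta>F unfolding club_def by blast
    moreover have "\<delta> \<in> closure_points r h"
      using \<delta>F E(1)[OF \<delta>(1)] unfolding closure_points_def by blast
    ultimately have "\<not> \<mu> \<le>o |nbrs G v \<inter> underS r \<delta>|"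
      using D(2) v unfolding B_def by blast
    then show ?thesis
      using not_ordLeq_iff_ordLess[OF card_of_Well_order wo\<mu>] by blast
  qed
  show ?thesis
  proof (rule col_bound_glue[OF \<mu> wo])
    show "E \<subseteq> Field r"
      using EW r(2) by simp
    show "W = (\<Union>\<delta>\<in>E. underS r \<delta>)"
      using cof dom by blast
    fix i assume i: "i \<in> E"
    have "|underS r i| <o |W|"
      using card_of_underS[OF r(1), of i] i EW r(2) unfolding r_def by blast
    then show "col_bound (induced G (underS r i)) \<mu>"
      by (rule IH[OF dom])
    define X where "X = (\<Union>\<delta>\<in>E \<inter> underS r i. underS r \<delta>)"
    fix v assume v: "v \<in> W" "v \<notin> (\<Union>\<delta>\<in>E \<inter> underS r i. underS r \<delta>)"
    have "|nbrs G v \<inter> X| <o \<mu>"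
    proof (cases "X = {}")
      case True
      then show ?thesis
        using finite_ordLess_infinite[OF card_of_Well_order wo\<mu> _ \<mu>(2), of "{}::'a set"]
        by (simp add: Field_card_of)
    next
      case False
      have "W - X \<subseteq> Field r" "W - X \<noteq> {}"
        using v r(2) unfolding X_def by auto
      then obtain \<delta> where \<delta>: "\<delta> \<in> W - X" "\<And>x. x \<in> W - X \<Longrightarrow> x \<notin> underS r \<delta>"
        using Well_order_least[OF wo, of "W - X"] by blast
      \<comment> \<open>The union of the earlier pieces is again a segment cut off at a point of
        \<open>E\<close>, namely at the least point outside it, so \<open>sparse\<close> applies to
        it.\<close>
      have X: "X = underS r \<delta>"
      proof
        show "underS r \<delta> \<subseteq> X"
          using \<delta>(2) dom by blast
        show "X \<subseteq> underS r \<delta>"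
        proof
          fix x assume "x \<in> X"
          then obtain \<epsilon> where \<epsilon>: "\<epsilon> \<in> E" "\<epsilon> \<in> underS r i" "x \<in> underS r \<epsilon>"
            unfolding X_def by blast
          then have "\<delta> \<notin> underS r \<epsilon>"
            using \<delta>(1) unfolding X_def by blast
          then have "\<delta> \<noteq> x \<and> \<delta> \<notin> underS r x"
            using \<epsilon>(3) underS_trans[OF wo] by blast
          then show "x \<in> underS r \<delta>"
            using underS_linear[OF wo, of x \<delta>] \<delta>(1) r(2) in_Field_underS[OF \<epsilon>(3)] by blast
        qed
      qed
      have "k x \<in> X" if "x \<in> X" for x
        using that unfolding X_def E_def closure_points_def by blast
      then have "\<delta> \<in> E"
        using \<delta>(1) r(2) unfolding X E_def closure_points_def by blast
      then show ?thesis
        using sparse[of \<delta> v] v False unfolding X[symmetric] X_def[symmetric] by blast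
    qed
    then show "|nbrs G v \<inter> (\<Union>\<delta>\<in>E \<inter> underS r i. underS r \<delta>)| <o \<mu>"
      unfolding X_def .
  qed
qed

section \<open>Induction on the number of vertices\<close>

lemma col_bound_if_no_obstruction:
  fixes G :: "'a ugraph" and \<mu> :: "'m rel"
  assumes \<mu>: "Card_order \<mu>" "infinite (Field \<mu>)" and G: "simple_graph G"
    and no: "\<And>H. subgraph H G \<Longrightarrow> \<not> obstruction_I \<mu> H \<and> \<not> obstruction_II \<mu> H"
  shows "col_bound G \<mu>"
proof -
  have card_rich: "|rich \<mu> G X| \<le>o |X|" if "X \<subseteq> verts G" "\<mu> \<le>o |X|" for X
    using card_rich_ordLeq[OF \<mu> G] no that by blast
  have "W \<subseteq> verts G \<longrightarrow> c = |W| \<longrightarrow> col_bound (induced G W) \<mu>" for c W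
  proof (induction c arbitrary: W rule: wf_induct[OF wf_ordLess])
    case (1 c)
    show ?case
    proof (intro impI)
      assume W: "W \<subseteq> verts G" "c = |W|"
      then have IH: "col_bound (induced G U) \<mu>" if "U \<subseteq> W" "|U| <o |W|" for U
        using 1 that by blast
      have "subgraph (induced G W) G"
        using simple_graph_induced[OF G] W(1) unfolding subgraph_def by (simp add: induced_def)
      then have noII: "\<not> obstruction_II \<mu> (induced G W)"
        using no by blast
      have "Well_order \<mu>"
        using \<mu>(1) by (simp add: card_order_on_def)
      then consider "|W| \<le>o \<mu>" | "\<mu> <o |W|"
        using ordLess_or_ordLeq[OF _ card_of_Well_order] by blast
      then show "col_bound (induced G W) \<mu>"
      proof cases
        \<comment> \<open>In an order of type |W| every vertex has fewer than |W| predecessors,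
          which is good enough up to \<mu>.\<close>
        case 1
        then show ?thesis
          using col_bound_mono[OF col_bound_card_of[of "induced G W"]] by simp
      next
        case 2
        then show ?thesis
          using col_bound_singular[OF \<mu> card_rich W(1) _ _ IH]
            col_bound_regular[OF \<mu> G card_rich W(1) _ _ noII IH] by blast
      qed
    qed
  qed
  then have "col_bound (induced G (verts G)) \<mu>"
    by blast
  moreover have "induced G (verts G) = G"
    using G unfolding simple_graph_def induced_def by (cases G) auto
  ultimately show ?thesis
    by simp
qed

theorem theorem1p2:
  fixes G :: "'a ugraph" and \<mu> :: "'m rel"
  assumes "simple_graph G"
    and "Card_order \<mu>" and "infinite (Field \<mu>)"
  shows "\<mu> <o col G \<longleftrightarrow>
    (\<exists>H. subgraph H G \<and> (obstruction_I \<mu> H \<or> obstruction_II \<mu> H))"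
proof -
  have wo: "Well_order \<mu>" "Well_order (col G)"
    using assms(2) Card_order_col[of G] by (simp_all add: card_order_on_def)
  have "col G \<le>o \<mu> \<longleftrightarrow> col_bound G \<mu>"
    using col_least[OF assms(2)] col_bound_mono[OF col_bound_col] by blast
  then have "\<mu> <o col G \<longleftrightarrow> \<not> col_bound G \<mu>"
    using not_ordLeq_iff_ordLess[OF wo] by blast
  then show ?thesis
    using obstruction_imp_not_col_bound[OF assms(2,3,1)]
      col_bound_if_no_obstruction[OF assms(2,3,1)] by blast
qed

end
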